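(* Let $\mu\ge0$. There is a constant $C_{e,\mu}$, with $C_{e,\mu}>1$ if $\mu>0$ and $C_{e,0}=1$, satisfying $$\int_{\mathbf{C}}|z|^2|f_e(z)|^2\,d\nu_{o,\mu}(z)\le C_{e,\mu}E_{e,\mu}(f_e)\quad\text{for all }f_e\in\mathcal{B}^2_{e,\mu},$$ and for every $c>1$ there are finite constants $\tau_e(c)$, $\tau_o(c)$ (depending also on $\mu$) satisfying $$E_{e,\mu}(f_e)\le c\,S_{L^2(\nu_{e,\mu})}(f_e)+\tau_e(c)\|f_e\|^2_{L^2(\nu_{e,\mu})},\qquad E_{o,\mu}(f_o)\le c\,S_{L^2(\nu_{o,\mu})}(f_o)+\tau_o(c)\|f_o\|^2_{L^2(\nu_{o,\mu})}$$ for all $f_e\in\mathcal{B}^2_{e,\mu}$ and $f_o\in\mathcal{B}^2_{o,\mu}$, such that with these constants the following hold. For every $f_e\in\mathcal{B}^2_{e,\mu}$, $$\|D_\mu f_e\|^2_{\mathcal{B}^2_\mu}\le c\,C_{e,\mu}S_{L^2(\nu_{e,\mu})}(f_e)+\left(C_{e,\mu}\tau_e(c)-(1+2\mu)\right)\|f_e\|^2_{L^2(\nu_{e,\mu})}.$$ For every $f_o\in\mathcal{B}^2_{o,\mu}$, $$\|D_\mu f_o\|^2_{\mathcal{B}^2_\mu}\le c\,S_{L^2(\nu_{o,\mu})}(f_o)+\left(\tau_o(c)-(1-2\mu)\right)\|f_o\|^2_{L^2(\nu_{o,\mu})}.$$ For every $f=f_e+f_o\in\mathcal{B}^2_\mu$,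 $$\|D_\mu f\|^2_{\mathcal{B}^2_\mu}\le c\,C_{e,\mu}S_{L^2(\nu_{e,\mu})}(f_e)+c\,S_{L^2(\nu_{o,\mu})}(f_o)+\left(C_{e,\mu}\tau_e(c)-(1+2\mu)\right)\|f_e\|^2_{L^2(\nu_{e,\mu})}+\left(\tau_o(c)-(1-2\mu)\right)\|f_o\|^2_{L^2(\nu_{o,\mu})}.$$
   Context: Fix $\mu\ge0$. For $x>0$ and $\alpha\in\mathbf{R}$, $K_\alpha(x)=\int_0^\infty e^{-x\cosh u}\cosh(\alpha u)\,du$ is the Macdonald function. On $\mathbf{C}$ define the finite measures $d\nu_{e,\mu}(z)=\nu_{e,\mu}(z)\,dx\,dy$ and $d\nu_{o,\mu}(z)=\nu_{o,\mu}(z)\,dx\,dy$ with densities, for $z\neq0$, $$\nu_{e,\mu}(z)=\frac{2^{\frac12-\mu}}{\pi\Gamma(\mu+\frac12)}K_{\mu-\frac12}(|z|^2)|z|^{2\mu+1},\qquad \nu_{o,\mu}(z)=\frac{2^{\frac12-\mu}}{\pi\Gamma(\mu+\frac12)}K_{\mu+\frac12}(|z|^2)|z|^{2\mu+1}.$$ For $f:\mathbf{C}\to\mathbf{C}$, $f_e(z)=(f(z)+f(-z))/2$ and $f_o(z)=(f(z)-f(-z))/2$ are its even and odd parts. $\mathcal{B}^2_\mu$ is the space of entire functions $f$ with $f_e\in L^2(\mathbf{C},\nu_{e,\mu})$ and $f_o\in L^2(\mathbf{C},\nu_{o,\mu})$, with norm $\|f\|^2_{\mathcal{B}^2_\mu}=\|f_e\|^2_{L^2(\nu_{e,\mu})}+\|f_o\|^2_{L^2(\nu_{o,\mu})}$;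 $\mathcal{B}^2_{e,\mu}$ and $\mathcal{B}^2_{o,\mu}$ are its subspaces of even and odd functions. Entropy: for a finite measure space $(\Omega,\nu)$ and $f\in L^2(\Omega,\nu)$, $S_{L^2(\Omega,\nu)}(f)=\int_\Omega|f|^2\log|f|^2\,d\nu-\|f\|^2_{L^2}\log\|f\|^2_{L^2}\in(-\infty,+\infty]$, with $0\log0=0$; here $\Omega=\mathbf{C}$. $\mu$-deformed energies (values in $[0,+\infty]$): $E_{e,\mu}(g)=\int_{\mathbf{C}}|z|^2|g(z)|^2\,d\nu_{e,\mu}(z)$ for $g\in\mathcal{B}^2_{e,\mu}$ and $E_{o,\mu}(h)=\int_{\mathbf{C}}|z|^2|h(z)|^2\,d\nu_{o,\mu}(z)$ for $h\in\mathcal{B}^2_{o,\mu}$. For an entire function $f$, $D_\mu f(z)=f'(z)+\frac{\mu}{z}(f(z)-f(-z))$ (removable singularity at $0$). The Dirichlet energy of $f\in\mathcal{B}^2_\mu$ is $\|D_\mu f\|^2_{\mathcal{B}^2_\mu}$ if $D_\mu f\in\mathcal{B}^2_\mu$ and $+\infty$ otherwise. *)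

theory Defs
  imports "HOL-Complex_Analysis.Complex_Analysis"
begin

definition macdonald :: "real \<Rightarrow> real \<Rightarrow> real" where
  "macdonald \<alpha> x = (LINT u:{0..}|lborel. exp (- x * cosh u) * cosh (\<alpha> * u))"

text \<open>The densities are only specified off the origin. The value at \<open>0\<close> here is \<open>0\<close>
  because \<open>0 powr a = 0\<close>; the origin is a null set, so this choice is immaterial.\<close>

definition nu_e_density :: "real \<Rightarrow> complex \<Rightarrow> real" where
  "nu_e_density \<mu> z = 2 powr (1/2 - \<mu>) / (pi * Gamma (\<mu> + 1/2))
     * macdonald (\<mu> - 1/2) ((cmod z)\<^sup>2) * cmod z powr (2 * \<mu> + 1)"

definition nu_o_density :: "real \<Rightarrow> complex \<Rightarrow> real" where
  "nu_o_density \<mu> z = 2 powr (1/2 - \<mu>) / (pi * Gamma (\<mu> + 1/2))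
     * macdonald (\<mu> + 1/2) ((cmod z)\<^sup>2) * cmod z powr (2 * \<mu> + 1)"

definition nu_e :: "real \<Rightarrow> complex measure" where
  "nu_e \<mu> = density lborel (\<lambda>z. ennreal (nu_e_density \<mu> z))"

definition nu_o :: "real \<Rightarrow> complex measure" where
  "nu_o \<mu> = density lborel (\<lambda>z. ennreal (nu_o_density \<mu> z))"

definition L2 :: "'a measure \<Rightarrow> ('a \<Rightarrow> complex) set" where
  "L2 M = {f \<in> borel_measurable M. integrable M (\<lambda>x. (cmod (f x))\<^sup>2)}"

definition L2_normsq :: "'a measure \<Rightarrow> ('a \<Rightarrow> complex) \<Rightarrow> real" where
  "L2_normsq M f = (LINT x|M. (cmod (f x))\<^sup>2)"

definition even_part :: "(complex \<Rightarrow> complex) \<Rightarrow> complex \<Rightarrow> complex" where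
  "even_part f z = (f z + f (- z)) / 2"

definition odd_part :: "(complex \<Rightarrow> complex) \<Rightarrow> complex \<Rightarrow> complex" where
  "odd_part f z = (f z - f (- z)) / 2"

definition B :: "real \<Rightarrow> (complex \<Rightarrow> complex) set" where
  "B \<mu> = {f. f holomorphic_on UNIV \<and> even_part f \<in> L2 (nu_e \<mu>) \<and> odd_part f \<in> L2 (nu_o \<mu>)}"

definition B_normsq :: "real \<Rightarrow> (complex \<Rightarrow> complex) \<Rightarrow> real" where
  "B_normsq \<mu> f = L2_normsq (nu_e \<mu>) (even_part f) + L2_normsq (nu_o \<mu>) (odd_part f)"

definition B_e :: "real \<Rightarrow> (complex \<Rightarrow> complex) set" where
  "B_e \<mu> = {f \<in> B \<mu>. \<forall>z. f (- z) = f z}"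

definition B_o :: "real \<Rightarrow> (complex \<Rightarrow> complex) set" where
  "B_o \<mu> = {f \<in> B \<mu>. \<forall>z. f (- z) = - f z}"

text \<open>The integral of \<open>\<bar>f\<bar>\<^sup>2 log \<bar>f\<bar>\<^sup>2\<close> may be \<open>+\<infinity>\<close>, so it is split into its positive and
  negative parts (\<open>ennreal\<close> truncates negative reals to \<open>0\<close>). On a finite measure space the
  negative part is finite since \<open>t log t \<ge> - 1 / e\<close>, so \<open>\<infinity> - \<infinity>\<close> does not occur. The convention
  \<open>0 log 0 = 0\<close> holds because \<open>ln 0 = 0\<close>.\<close>

definition entropy_L2 :: "'a measure \<Rightarrow> ('a \<Rightarrow> complex) \<Rightarrow> ereal" where
  "entropy_L2 M f =
     enn2ereal (\<integral>\<^sup>+x. ennreal ((cmod (f x))\<^sup>2 * ln ((cmod (f x))\<^sup>2)) \<partial>M)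
     - enn2ereal (\<integral>\<^sup>+x. ennreal (- ((cmod (f x))\<^sup>2 * ln ((cmod (f x))\<^sup>2))) \<partial>M)
     - ereal (L2_normsq M f * ln (L2_normsq M f))"

definition E_e :: "real \<Rightarrow> (complex \<Rightarrow> complex) \<Rightarrow> ennreal" where
  "E_e \<mu> g = (\<integral>\<^sup>+z. ennreal ((cmod z)\<^sup>2 * (cmod (g z))\<^sup>2) \<partial>nu_e \<mu>)"

definition E_o :: "real \<Rightarrow> (complex \<Rightarrow> complex) \<Rightarrow> ennreal" where
  "E_o \<mu> h = (\<integral>\<^sup>+z. ennreal ((cmod z)\<^sup>2 * (cmod (h z))\<^sup>2) \<partial>nu_o \<mu>)"

definition D :: "real \<Rightarrow> (complex \<Rightarrow> complex) \<Rightarrow> complex \<Rightarrow> complex" where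
  "D \<mu> f = remove_sings (\<lambda>z. deriv f z + of_real \<mu> / z * (f z - f (- z)))"

lemma D_nonzero:
  assumes "f holomorphic_on UNIV" "z \<noteq> 0"
  shows "D \<mu> f z = deriv f z + of_real \<mu> / z * (f z - f (- z))"
proof -
  have f: "f analytic_on S" for S
    using assms(1) by (meson analytic_on_holomorphic open_UNIV top_greatest)
  have "(\<lambda>w. f (- w)) analytic_on {z}"
    using analytic_on_compose[of uminus "{z}" f, OF analytic_on_neg[OF analytic_on_ident] f]
    by (simp add: o_def)
  then have "(\<lambda>w. deriv f w + of_real \<mu> / w * (f w - f (- w))) analytic_on {z}"
    using f assms(2) by (intro analytic_intros) auto
  then show ?thesis
    unfolding D_def by (rule remove_sings_at_analytic)
qed

lemma D_zero:
  assumes "f holomorphic_on UNIV"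
  shows "D \<mu> f 0 = (1 + 2 * of_real \<mu>) * deriv f 0"
proof -
  have f: "(f has_field_derivative deriv f z) (at z)" for z
    using assms by (simp add: holomorphic_derivI)
  have "((\<lambda>w. f w - f (- w)) has_field_derivative 2 * deriv f 0) (at 0)"
    using f[of 0] by (auto intro!: derivative_eq_intros DERIV_chain2[of f "deriv f 0" uminus])
  then have lim: "(\<lambda>w. (f w - f (- w)) / w) \<midarrow>0\<rightarrow> 2 * deriv f 0"
    by (simp add: DERIV_def)
  have "deriv f holomorphic_on UNIV"
    using assms by (simp add: holomorphic_deriv)
  then have "isCont (deriv f) 0"
    by (metis UNIV_I continuous_on_eq_continuous_at holomorphic_on_imp_continuous_on open_UNIV)
  then have "(\<lambda>w. deriv f w + of_real \<mu> * ((f w - f (- w)) / w))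
      \<midarrow>0\<rightarrow> deriv f 0 + of_real \<mu> * (2 * deriv f 0)"
    by (intro tendsto_intros lim) (simp add: isCont_def)
  then have "remove_sings (\<lambda>w. deriv f w + of_real \<mu> / w * (f w - f (- w))) 0
      = deriv f 0 + of_real \<mu> * (2 * deriv f 0)"
    by (intro remove_sings_eqI) simp
  then show ?thesis
    by (simp add: D_def algebra_simps)
qed

definition dirichlet_energy :: "real \<Rightarrow> (complex \<Rightarrow> complex) \<Rightarrow> ereal" where
  "dirichlet_energy \<mu> f = (if D \<mu> f \<in> B \<mu> then ereal (B_normsq \<mu> (D \<mu> f)) else \<infinity>)"

end

theory Submission
  imports Defs
begin

text \<open>The densities are radial, so monomials are orthogonal and every quadratic quantity of an
  entire function \<open>f = \<Sum> a\<^sub>n z\<^sup>n\<close> is a sum of \<open>\<bar>a\<^sub>n\<bar>\<^sup>2\<close> against the moments \<open>p\<^sub>n\<close> and \<open>q\<^sub>n\<close> of \<open>\<bar>z\<bar>\<^bsup>2n\<^esup>\<close> for the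
  even and the odd measure. Writing the Macdonald function as an integral and exchanging the
  integrals reduces the moments to Gamma values times integrals of \<open>cosh (\<alpha> u) / cosh\<^sup>a u\<close>, and
  integration by parts in \<open>u\<close> yields \<open>q\<^bsub>n+1\<^esub> = (n + 1 + 2\<mu>) p\<^sub>n\<close> and \<open>p\<^bsub>n+1\<^esub> = (n + 1) q\<^sub>n\<close>. Since \<open>p\<^sub>n \<le> q\<^sub>n\<close>,
  these two relations give \<open>C = 1 + 2\<mu>\<close>, and, as the Dunkl derivative acts diagonally on coefficients, they also
  give the exact formulas for the Dirichlet energies. The energy-entropy inequalities are the
  Gibbs variational principle for \<open>\<bar>z\<bar>\<^sup>2 / c\<close>, whose exponential is integrable because the densities
  decay like \<open>exp (- \<bar>z\<bar>\<^sup>2)\<close> and \<open>c > 1\<close>.\<close>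

section \<open>Lebesgue measure on the complex plane\<close>

text \<open>Lebesgue measure is determined by its values on boxes, and a complex box is a product of
  two real intervals. This opens the way to Tonelli in the coordinates \<open>Re\<close> and
  \<open>Im\<close>.\<close>

lemma lborel_complex_eq_distr:
  "(lborel :: complex measure) = distr (lborel \<Otimes>\<^sub>M lborel) borel (\<lambda>(x, y). Complex x y)"
proof (rule lborel_eqI)
  have meas [measurable]: "(\<lambda>p. Complex (fst p) (snd p)) \<in> borel_measurable (lborel \<Otimes>\<^sub>M lborel)"
  proof -
    have "continuous_on UNIV (\<lambda>p. Complex (fst p) (snd p))"
      by (intro continuous_intros)
    then show ?thesis
      by (simp add: lborel_prod borel_measurable_continuous_onI)
  qed
  fix l u :: complex
  assume le: "\<And>b. b \<in> Basis \<Longrightarrow> l \<bullet> b \<le> u \<bullet> b"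
  have le': "Re l \<le> Re u" "Im l \<le> Im u"
    using le[of 1] le[of \<i>] by (auto simp: Basis_complex_def)
  have "emeasure (distr (lborel \<Otimes>\<^sub>M lborel) borel (\<lambda>(x, y). Complex x y)) (box l u)
    = emeasure (lborel \<Otimes>\<^sub>M lborel) ({Re l<..<Re u} \<times> {Im l<..<Im u})"
    by (subst emeasure_distr) (auto simp: case_prod_beta' box_Complex_eq in_box_complex_iff space_pair_measure intro!: arg_cong[where f="emeasure _"])
  also have "\<dots> = ennreal (Re u - Re l) * ennreal (Im u - Im l)"
    using le' by (subst lborel.emeasure_pair_measure_Times) auto
  also have "\<dots> = ennreal (\<Prod>b\<in>Basis. (u - l) \<bullet> b)"
    using le' by (simp add: Basis_complex_def ennreal_mult)
  finally show "emeasure (distr (lborel \<Otimes>\<^sub>M lborel) borel (\<lambda>(x, y). Complex x y)) (box l u) = (\<Prod>b\<in>Basis. (u - l) \<bullet> b)" .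
qed simp

lemma measurable_Complex [measurable (raw)]:
  assumes "f \<in> borel_measurable M" "g \<in> borel_measurable M"
  shows "(\<lambda>x. Complex (f x) (g x)) \<in> borel_measurable M"
  using assms by (simp add: Complex_eq)

lemma nn_integral_lborel_complex:
  assumes [measurable]: "F \<in> borel_measurable borel"
  shows "(\<integral>\<^sup>+z. F z \<partial>lborel) = (\<integral>\<^sup>+x. \<integral>\<^sup>+y. F (Complex x y) \<partial>lborel \<partial>lborel)"
  by (subst lborel_complex_eq_distr, subst nn_integral_distr)
     (simp_all add: case_prod_beta' lborel.nn_integral_fst[symmetric] measurable_Complex)

lemma nn_integral_lborel_complex':
  assumes [measurable]: "F \<in> borel_measurable borel"
  shows "(\<integral>\<^sup>+z. F z \<partial>lborel) = (\<integral>\<^sup>+y. \<integral>\<^sup>+x. F (Complex x y) \<partial>lborel \<partial>lborel)"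
  unfolding nn_integral_lborel_complex[OF assms] by (rule lborel_pair.Fubini') measurable

section \<open>Invariance under shears and rotations, and radial integrals\<close>

text \<open>For fixed imaginary part the shear is a translation of the real line, so the inner
  integral does not change.\<close>

lemma nn_integral_lborel_shear_Re:
  assumes [measurable]: "F \<in> borel_measurable (borel :: complex measure)"
  shows "(\<integral>\<^sup>+z. F (Complex (Re z + t * Im z) (Im z)) \<partial>lborel) = (\<integral>\<^sup>+z. F z \<partial>lborel)"
proof -
  have "(\<integral>\<^sup>+x. F (Complex (x + t * y) y) \<partial>lborel) = (\<integral>\<^sup>+x. F (Complex x y) \<partial>lborel)" for y
    using nn_integral_real_affine[of "\<lambda>x. F (Complex x y)" 1 "t * y"] by (simp add: add.commute)
  then show ?thesis
    by (simp add: nn_integral_lborel_complex')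
qed

lemma nn_integral_lborel_shear_Im:
  assumes [measurable]: "F \<in> borel_measurable (borel :: complex measure)"
  shows "(\<integral>\<^sup>+z. F (Complex (Re z) (Im z + t * Re z)) \<partial>lborel) = (\<integral>\<^sup>+z. F z \<partial>lborel)"
proof -
  have "(\<integral>\<^sup>+y. F (Complex x (y + t * x)) \<partial>lborel) = (\<integral>\<^sup>+y. F (Complex x y) \<partial>lborel)" for x
    using nn_integral_real_affine[of "\<lambda>y. F (Complex x y)" 1 "t * x"] by (simp add: add.commute)
  then show ?thesis
    by (simp add: nn_integral_lborel_complex)
qed

lemma nn_integral_lborel_rotate:
  assumes [measurable]: "F \<in> borel_measurable (borel :: complex measure)" and c: "cmod c = 1"
  shows "(\<integral>\<^sup>+z. F (c * z) \<partial>lborel) = (\<integral>\<^sup>+z. F z \<partial>lborel)"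
proof -
  text \<open>A rotation by an angle other than \<open>\<pi>\<close> is a product of three shears.\<close>
  have *: "(\<integral>\<^sup>+z. F (c * z) \<partial>lborel) = (\<integral>\<^sup>+z. F z \<partial>lborel)"
    if [measurable]: "F \<in> borel_measurable borel" and c: "cmod c = 1" "c \<noteq> -1" for F c
  proof -
    \<comment> \<open>For a rotation by the angle \<theta> this is tan(\<theta>/2). The rotation is
      the real shear by \<open>- t\<close>, then the imaginary shear by sin \<theta>, then the real
      shear by \<open>- t\<close> again.\<close>
    define t where "t = Im c / (1 + Re c)"
    have sq: "(Re c)\<^sup>2 + (Im c)\<^sup>2 = 1"
      using c(1) cmod_power2[of c] by simp
    have "Re c \<noteq> -1"
      using sq c(2) by (auto simp: complex_eq_iff)
    then have n: "1 + Re c \<noteq> 0" by linarith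
    have t1: "1 - t * Im c = Re c"
      using n sq by (simp add: t_def field_simps power2_eq_square)
    have t2: "t * (1 + Re c) = Im c"
      using n by (simp add: t_def)
    define F1 where "F1 = (\<lambda>z. F (Complex (Re z + (- t) * Im z) (Im z)))"
    define F2 where "F2 = (\<lambda>z. F1 (Complex (Re z) (Im z + Im c * Re z)))"
    have [measurable]: "F1 \<in> borel_measurable borel" "F2 \<in> borel_measurable borel"
      unfolding F1_def F2_def by measurable
    have "F (c * z) = F2 (Complex (Re z + (- t) * Im z) (Im z))" for z
    proof -
      have "c * z = Complex (Re z - t * Im z - t * (Im z + Im c * (Re z - t * Im z)))
            (Im z + Im c * (Re z - t * Im z))"
        unfolding complex_eq_iff using t1[symmetric] t2 by (auto simp: algebra_simps) algebra+
      then show ?thesis by (simp add: F1_def F2_def)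
    qed
    then have "(\<integral>\<^sup>+z. F (c * z) \<partial>lborel) = (\<integral>\<^sup>+z. F2 z \<partial>lborel)"
      using nn_integral_lborel_shear_Re[of F2 "- t"] by simp
    also have "\<dots> = (\<integral>\<^sup>+z. F1 z \<partial>lborel)"
      unfolding F2_def by (rule nn_integral_lborel_shear_Im) measurable
    also have "\<dots> = (\<integral>\<^sup>+z. F z \<partial>lborel)"
      unfolding F1_def by (rule nn_integral_lborel_shear_Re) measurable
    finally show ?thesis .
  qed
  \<comment> \<open>The principal root has nonnegative real part, hence is never -1. Rotating twice
    by it therefore also covers \<open>c = -1\<close>.\<close>
  define d where "d = csqrt c"
  have "0 \<le> Re d"
    using csqrt_principal[of c] by (auto simp: d_def)
  then have d: "d * d = c" "cmod d = 1" "d \<noteq> -1"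
    using c by (auto simp: d_def power2_eq_square[symmetric] simp del: csqrt.simps)
  have "(\<integral>\<^sup>+z. F (c * z) \<partial>lborel) = (\<integral>\<^sup>+z. F (d * (d * z)) \<partial>lborel)"
    by (simp add: d(1)[symmetric] mult.assoc)
  also have "\<dots> = (\<integral>\<^sup>+z. F (d * z) \<partial>lborel)"
    using d by (intro *[of "\<lambda>z. F (d * z)"]) auto
  also have "\<dots> = (\<integral>\<^sup>+z. F z \<partial>lborel)"
    using d by (intro *) auto
  finally show ?thesis .
qed

text \<open>The disc of radius sqrt x has area pi x, so the image of Lebesgue measure under the
  squared modulus is pi times Lebesgue measure on the half-line. Comparing both measures on the sets
  \<open>{..x}\<close> takes the place of polar coordinates.\<close>

lemma nn_integral_lborel_complex_radial:
  fixes F :: "real \<Rightarrow> ennreal"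
  assumes [measurable]: "F \<in> borel_measurable borel"
  shows "(\<integral>\<^sup>+z. F ((cmod z)\<^sup>2) \<partial>lborel) = ennreal pi * (\<integral>\<^sup>+s\<in>{0..}. F s \<partial>lborel)"
proof -
  let ?f = "\<lambda>z::complex. (cmod z)\<^sup>2"
  let ?N = "density lborel (\<lambda>s::real. ennreal pi * indicator {0..} s)"
  have eq: "distr (lborel :: complex measure) borel ?f = ?N"
  proof (rule measure_eqI_generator_eq[where E = "range atMost" and \<Omega> = UNIV and A = "\<lambda>n. {..real n}"])
    show "Int_stable (range (atMost :: real \<Rightarrow> _))"
      by (auto simp: Int_stable_def)
  next
    fix X assume "X \<in> range (atMost :: real \<Rightarrow> _)"
    then obtain x where X: "X = {..x}" by auto
    have vim: "?f -` {..x} = (if x < 0 then {} else cball 0 (sqrt x))"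
    proof (cases "x < 0")
      case True
      have "\<not> (cmod z)\<^sup>2 \<le> x" for z
        using True zero_le_power2[of "cmod z"] by linarith
      then show ?thesis using True by auto
    next
      case False
      then show ?thesis
        by (auto simp: real_le_rsqrt intro: sqrt_ge_absD) (metis abs_norm_cancel sqrt_ge_absD)
    qed
    have 1: "emeasure (distr (lborel :: complex measure) borel ?f) X = ennreal (pi * max 0 x)"
      unfolding X by (subst emeasure_distr) (auto simp: vim emeasure_cball eval_unit_ball_vol)
    have "emeasure ?N X = (\<integral>\<^sup>+s. ennreal pi * indicator {0..x} s \<partial>lborel)"
      unfolding X by (subst emeasure_density) (auto intro!: nn_integral_cong simp: indicator_def)
    also have "\<dots> = ennreal (pi * max 0 x)"
      by (subst nn_integral_cmult) (auto simp: ennreal_mult' max_def)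
    finally show "emeasure (distr (lborel :: complex measure) borel ?f) X = emeasure ?N X"
      using 1 by simp
  next
    fix n :: nat
    have vim: "?f -` {..real n} = cball 0 (sqrt (real n))"
      by (auto simp: real_le_rsqrt intro: sqrt_ge_absD) (metis abs_norm_cancel sqrt_ge_absD)
    show "emeasure (distr (lborel :: complex measure) borel ?f) {..real n} \<noteq> \<infinity>"
      by (subst emeasure_distr) (auto simp: vim emeasure_cball)
  next
    show "(\<Union>i. {..real i}) = UNIV"
      using real_arch_simple by auto
  qed (auto simp: borel_eq_atMost)
  have "(\<integral>\<^sup>+z. F ((cmod z)\<^sup>2) \<partial>lborel) = (\<integral>\<^sup>+s. F s \<partial>?N)"
    by (subst eq[symmetric], subst nn_integral_distr) auto
  also have "\<dots> = (\<integral>\<^sup>+s. ennreal pi * (F s * indicator {0..} s) \<partial>lborel)"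
    by (subst nn_integral_density) (auto simp: mult_ac)
  also have "\<dots> = ennreal pi * (\<integral>\<^sup>+s\<in>{0..}. F s \<partial>lborel)"
    by (rule nn_integral_cmult) auto
  finally show ?thesis .
qed

section \<open>Parseval identity for radial weights\<close>

text \<open>A geometric sum whose ratio is an N-th root of unity; distinct exponents below
  \<open>N\<close> make the ratio different from 1.\<close>

lemma sum_roots_of_unity_orthogonal:
  fixes N n m :: nat
  assumes nm: "n < N" "m < N"
  defines "\<omega> \<equiv> cis (2 * pi / N)"
  shows "(\<Sum>j<N. (\<omega> ^ j) ^ n * cnj ((\<omega> ^ j) ^ m)) = (if n = m then of_nat N else 0)"
proof -
  \<comment> \<open>This is the power of \<omega> with exponent n - m, a possibly negative integer;
    conjugation inverts on the unit circle.\<close>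
  define q where "q = \<omega> ^ n * cnj (\<omega> ^ m)"
  have eq: "(\<omega> ^ j) ^ n * cnj ((\<omega> ^ j) ^ m) = q ^ j" for j
    by (simp add: q_def power_mult_distrib flip: power_mult) (simp add: mult.commute)
  have unit: "\<omega> ^ m * cnj (\<omega> ^ m) = 1" for m
    by (simp add: \<omega>_def flip: power_mult_distrib complex_norm_square)
  show ?thesis
  proof (cases "n = m")
    case True
    then have "q = 1" using unit by (simp add: q_def)
    then show ?thesis unfolding eq using True by simp
  next
    case False
    have pw: "\<omega> ^ k = cis (2 * pi * k / N)" for k
      unfolding \<omega>_def Complex.DeMoivre by (rule arg_cong[where f = cis]) simp
    have inj: "inj_on (\<lambda>k. cis (2 * pi * real k / real N)) {..<N}"
      using Complex.bij_betw_roots_unity[of N] nm by (auto simp: bij_betw_def)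
    have "\<omega> ^ n \<noteq> \<omega> ^ m"
      using inj_onD[OF inj, of n m] False nm by (auto simp: pw)
    moreover have "\<omega> ^ n = q * \<omega> ^ m"
      using unit[of m] by (simp add: q_def mult_ac)
    ultimately have "q \<noteq> 1" by auto
    have "\<omega> ^ N = 1"
      using nm by (simp add: pw)
    then have "(\<omega> ^ k) ^ N = 1" for k
      by (metis mult.commute power_mult power_one)
    then have "q ^ N = 1"
      by (simp only: q_def power_mult_distrib complex_cnj_power[symmetric]) simp
    then show ?thesis
      unfolding eq using \<open>q \<noteq> 1\<close> False by (simp add: geometric_sum)
  qed
qed

text \<open>A finite substitute for integrating over a circle: with \<open>N\<close> rotations and
  degree below \<open>N\<close>, orthogonality removes all cross terms exactly.\<close>

lemma sum_norm_polynomial_roots_of_unity: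
  fixes a :: "nat \<Rightarrow> complex" and z :: complex and N :: nat
  defines "\<omega> \<equiv> cis (2 * pi / N)"
  shows "(\<Sum>j<N. (cmod (\<Sum>n<N. a n * (\<omega> ^ j * z) ^ n))\<^sup>2) = N * (\<Sum>n<N. (cmod (a n))\<^sup>2 * (cmod z) ^ (2 * n))"
proof -
  let ?c = "\<lambda>n m. a n * cnj (a m) * z ^ n * cnj (z ^ m)"
  have "complex_of_real (\<Sum>j<N. (cmod (\<Sum>n<N. a n * (\<omega> ^ j * z) ^ n))\<^sup>2)
    = (\<Sum>j<N. \<Sum>n<N. \<Sum>m<N. ?c n m * ((\<omega> ^ j) ^ n * cnj ((\<omega> ^ j) ^ m)))"
    unfolding of_real_sum complex_norm_square
    by (simp add: sum_product power_mult_distrib mult_ac)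
  also have "\<dots> = (\<Sum>n<N. \<Sum>m<N. ?c n m * (\<Sum>j<N. (\<omega> ^ j) ^ n * cnj ((\<omega> ^ j) ^ m)))"
    by (subst sum.swap, rule sum.cong[OF refl], subst sum.swap) (simp only: sum_distrib_left)
  also have "\<dots> = (\<Sum>n<N. \<Sum>m<N. ?c n m * (if n = m then of_nat N else 0))"
    unfolding \<omega>_def by (intro sum.cong refl) (subst sum_roots_of_unity_orthogonal, auto)
  also have "\<dots> = (\<Sum>n<N. ?c n n * of_nat N)"
    by (intro sum.cong refl) (simp add: if_distrib sum.delta cong: if_cong)
  also have "\<dots> = (\<Sum>n<N. of_real ((cmod (a n))\<^sup>2 * (cmod z) ^ (2 * n)) * of_nat N)"
  proof (intro sum.cong refl)
    fix n
    have "a n * cnj (a n) * (z ^ n * cnj (z ^ n)) = of_real ((cmod (a n))\<^sup>2) * of_real ((cmod (z ^ n))\<^sup>2)"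
      by (simp only: complex_norm_square)
    then show "?c n n * of_nat N = of_real ((cmod (a n))\<^sup>2 * (cmod z) ^ (2 * n)) * of_nat N"
      by (simp add: norm_power mult_ac flip: power_mult)
  qed
  also have "\<dots> = complex_of_real (N * (\<Sum>n<N. (cmod (a n))\<^sup>2 * (cmod z) ^ (2 * n)))"
    by (simp add: sum_distrib_left mult_ac)
  finally show ?thesis
    by (simp only: of_real_eq_iff)
qed

text \<open>Each of the \<open>N\<close> rotated copies of the polynomial has the same weighted
  integral. Summing over the rotations diagonalises the integrand, and the factor \<open>N\<close>
  then cancels.\<close>

lemma parseval_polynomial:
  fixes w :: "complex \<Rightarrow> ennreal" and a :: "nat \<Rightarrow> complex"
  assumes [measurable]: "w \<in> borel_measurable borel"
    and rad: "\<And>c z. cmod c = 1 \<Longrightarrow> w (c * z) = w z"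
  shows "(\<integral>\<^sup>+z. ennreal ((cmod (\<Sum>n<N. a n * z ^ n))\<^sup>2) * w z \<partial>lborel)
    = (\<Sum>n<N. ennreal ((cmod (a n))\<^sup>2) * (\<integral>\<^sup>+z. ennreal (cmod z ^ (2 * n)) * w z \<partial>lborel))"
proof (cases "N = 0")
  case False
  define \<omega> where "\<omega> = cis (2 * pi / N)"
  let ?p = "\<lambda>z. \<Sum>n<N. a n * z ^ n"
  have \<omega>: "cmod (\<omega> ^ j) = 1" for j
    by (simp add: \<omega>_def norm_power)
  have rot: "(\<integral>\<^sup>+z. ennreal ((cmod (?p (\<omega> ^ j * z)))\<^sup>2) * w z \<partial>lborel)
      = (\<integral>\<^sup>+z. ennreal ((cmod (?p z))\<^sup>2) * w z \<partial>lborel)" for j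
    using nn_integral_lborel_rotate[of "\<lambda>z. ennreal ((cmod (?p z))\<^sup>2) * w z" "\<omega> ^ j"] \<omega>
    by (simp add: rad)
  have "of_nat N * (\<integral>\<^sup>+z. ennreal ((cmod (?p z))\<^sup>2) * w z \<partial>lborel)
      = (\<Sum>j<N. \<integral>\<^sup>+z. ennreal ((cmod (?p (\<omega> ^ j * z)))\<^sup>2) * w z \<partial>lborel)"
    by (simp add: rot)
  also have "\<dots> = (\<integral>\<^sup>+z. (\<Sum>j<N. ennreal ((cmod (?p (\<omega> ^ j * z)))\<^sup>2) * w z) \<partial>lborel)"
    by (rule nn_integral_sum[symmetric]) measurable
  also have "\<dots> = (\<integral>\<^sup>+z. of_nat N * (\<Sum>n<N. ennreal ((cmod (a n))\<^sup>2) * (ennreal (cmod z ^ (2 * n)) * w z)) \<partial>lborel)"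
  proof (intro nn_integral_cong)
    fix z
    have "(\<Sum>j<N. ennreal ((cmod (?p (\<omega> ^ j * z)))\<^sup>2) * w z)
        = ennreal (\<Sum>j<N. (cmod (?p (\<omega> ^ j * z)))\<^sup>2) * w z"
      by (simp add: sum_distrib_right flip: sum_ennreal)
    also have "\<dots> = of_nat N * (\<Sum>n<N. ennreal ((cmod (a n))\<^sup>2) * (ennreal (cmod z ^ (2 * n)))) * w z"
      unfolding \<omega>_def sum_norm_polynomial_roots_of_unity
      by (simp add: ennreal_mult' ennreal_of_nat_eq_real_of_nat sum_nonneg flip: sum_ennreal)
    finally show "(\<Sum>j<N. ennreal ((cmod (?p (\<omega> ^ j * z)))\<^sup>2) * w z)
      = of_nat N * (\<Sum>n<N. ennreal ((cmod (a n))\<^sup>2) * (ennreal (cmod z ^ (2 * n)) * w z))"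
      by (simp only: mult.assoc sum_distrib_right)
  qed
  also have "\<dots> = of_nat N * (\<Sum>n<N. ennreal ((cmod (a n))\<^sup>2) * (\<integral>\<^sup>+z. ennreal (cmod z ^ (2 * n)) * w z \<partial>lborel))"
    by (simp add: nn_integral_cmult nn_integral_sum)
  finally show ?thesis
    using False by (subst (asm) ennreal_mult_cancel_left) auto
qed simp

section \<open>From polynomials to entire functions\<close>

lemma powser_everywhere_summable_norm:
  fixes a :: "nat \<Rightarrow> complex"
  assumes "\<And>z. (\<lambda>n. a n * z ^ n) sums F z" "0 \<le> R"
  shows "summable (\<lambda>n. cmod (a n) * R ^ n)"
proof -
  have "summable (\<lambda>n. cmod (a n * of_real R ^ n))"
    using assms(2) by (intro powser_insidea[of _ "of_real (R + 1)"] sums_summable[OF assms(1)]) auto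
  then show ?thesis
    using assms(2) by (simp add: norm_mult norm_power)
qed

lemma powser_everywhere_borel_measurable:
  fixes a :: "nat \<Rightarrow> complex"
  assumes "\<And>z. (\<lambda>n. a n * z ^ n) sums F z"
  shows "F \<in> borel_measurable borel"
proof (rule borel_measurable_LIMSEQ_metric)
  show "(\<lambda>z. \<Sum>n<N. a n * z ^ n) \<in> borel_measurable borel" for N
    by measurable
  show "(\<lambda>N. \<Sum>n<N. a n * z ^ n) \<longlonglongrightarrow> F z" for z
    using assms by (simp add: sums_def)
qed

text \<open>On a bounded support the partial sums are uniformly bounded, so dominated convergence
  carries the polynomial identity to the limit. Both sides are limits of the same sequence.\<close>

lemma parseval_bounded_support:
  fixes w :: "complex \<Rightarrow> ennreal" and a :: "nat \<Rightarrow> complex"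
  assumes w [measurable]: "w \<in> borel_measurable borel"
    and rad: "\<And>c z. cmod c = 1 \<Longrightarrow> w (c * z) = w z"
    and supp: "\<And>z. cmod z > R \<Longrightarrow> w z = 0"
    and fin: "(\<integral>\<^sup>+z. w z \<partial>lborel) < \<infinity>"
    and F: "\<And>z. (\<lambda>n. a n * z ^ n) sums F z"
  shows "(\<integral>\<^sup>+z. ennreal ((cmod (F z))\<^sup>2) * w z \<partial>lborel)
    = (\<Sum>n. ennreal ((cmod (a n))\<^sup>2) * (\<integral>\<^sup>+z. ennreal (cmod z ^ (2 * n)) * w z \<partial>lborel))"
proof (rule LIMSEQ_unique)
  note [measurable] = powser_everywhere_borel_measurable[OF F]
  let ?p = "\<lambda>N z. \<Sum>n<N. a n * z ^ n"
  \<comment> \<open>A common bound for all partial sums on the disc of radius \<open>R\<close>; the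
    absolute value keeps the series nonnegative whatever the sign of \<open>R\<close>.\<close>
  define B where "B = (\<Sum>n. cmod (a n) * \<bar>R\<bar> ^ n)"
  have summ: "summable (\<lambda>n. cmod (a n) * \<bar>R\<bar> ^ n)"
    by (rule powser_everywhere_summable_norm[OF F]) simp
  have bound: "cmod (?p N z) \<le> B" if "cmod z \<le> R" for N z
  proof -
    have "cmod (?p N z) \<le> (\<Sum>n<N. cmod (a n) * \<bar>R\<bar> ^ n)"
      using that by (intro sum_norm_le) (auto simp: norm_mult norm_power intro!: mult_left_mono power_mono)
    also have "\<dots> \<le> B"
      unfolding B_def by (rule sum_le_suminf[OF summ]) auto
    finally show ?thesis .
  qed
  show "(\<lambda>N. \<integral>\<^sup>+z. ennreal ((cmod (?p N z))\<^sup>2) * w z \<partial>lborel)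
      \<longlonglongrightarrow> (\<integral>\<^sup>+z. ennreal ((cmod (F z))\<^sup>2) * w z \<partial>lborel)"
  proof (rule nn_integral_dominated_convergence[where w = "\<lambda>z. ennreal (B\<^sup>2) * w z"])
    show "AE z in lborel. ennreal ((cmod (?p N z))\<^sup>2) * w z \<le> ennreal (B\<^sup>2) * w z" for N
    proof (rule AE_I2)
      fix z
      show "ennreal ((cmod (?p N z))\<^sup>2) * w z \<le> ennreal (B\<^sup>2) * w z"
        using bound[of z N] supp[of z]
        by (cases "cmod z \<le> R") (auto intro!: mult_right_mono ennreal_leI power_mono)
    qed
    show "(\<integral>\<^sup>+z. ennreal (B\<^sup>2) * w z \<partial>lborel) < \<infinity>"
      using fin by (subst nn_integral_cmult) (auto simp: ennreal_mult_less_top)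
    \<comment> \<open>Multiplication on \<open>ennreal\<close> is discontinuous at 0 times
      \<infinity>, so infinite values of the weight are excluded before passing to the
      limit.\<close>
    have finw: "AE z in lborel. w z \<noteq> \<infinity>"
      using fin by (intro nn_integral_noteq_infinite) auto
    show "AE z in lborel. (\<lambda>N. ennreal ((cmod (?p N z))\<^sup>2) * w z) \<longlonglongrightarrow> ennreal ((cmod (F z))\<^sup>2) * w z"
      using finw
    proof eventually_elim
      case (elim z)
      have "(\<lambda>N. ?p N z) \<longlonglongrightarrow> F z"
        using F by (simp add: sums_def)
      then have "(\<lambda>N. ennreal ((cmod (?p N z))\<^sup>2)) \<longlonglongrightarrow> ennreal ((cmod (F z))\<^sup>2)"
        by (intro tendsto_intros)
      then show ?case
        using elim by (intro tendsto_mult_ennreal tendsto_const) auto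
    qed
  qed measurable
  show "(\<lambda>N. \<integral>\<^sup>+z. ennreal ((cmod (?p N z))\<^sup>2) * w z \<partial>lborel)
     \<longlonglongrightarrow> (\<Sum>n. ennreal ((cmod (a n))\<^sup>2) * (\<integral>\<^sup>+z. ennreal (cmod z ^ (2 * n)) * w z \<partial>lborel))"
  proof -
    have "(\<lambda>N. \<integral>\<^sup>+z. ennreal ((cmod (?p N z))\<^sup>2) * w z \<partial>lborel)
       = (\<lambda>N. \<Sum>n<N. ennreal ((cmod (a n))\<^sup>2) * (\<integral>\<^sup>+z. ennreal (cmod z ^ (2 * n)) * w z \<partial>lborel))"
      by (intro ext parseval_polynomial w rad)
    then show ?thesis
      using summable_LIMSEQ by fastforce
  qed
qed

text \<open>The weight is cut into annuli, each of bounded support, and the pieces are added by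
  monotone convergence. Both sides may be infinite, so no integrability of \<open>F\<close>
  enters.\<close>

theorem parseval_radial:
  fixes w :: "complex \<Rightarrow> ennreal" and a :: "nat \<Rightarrow> complex"
  assumes w [measurable]: "w \<in> borel_measurable borel"
    and rad: "\<And>c z. cmod c = 1 \<Longrightarrow> w (c * z) = w z"
    and fin: "(\<integral>\<^sup>+z. w z \<partial>lborel) < \<infinity>"
    and F: "\<And>z. (\<lambda>n. a n * z ^ n) sums F z"
  shows "(\<integral>\<^sup>+z. ennreal ((cmod (F z))\<^sup>2) * w z \<partial>lborel)
    = (\<Sum>n. ennreal ((cmod (a n))\<^sup>2) * (\<integral>\<^sup>+z. ennreal (cmod z ^ (2 * n)) * w z \<partial>lborel))"
proof -
  note [measurable] = powser_everywhere_borel_measurable[OF F]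
  \<comment> \<open>The mean of the squared modulus of \<open>F\<close> over the circle through
    \<open>z\<close>, written as a series.\<close>
  define G where "G = (\<lambda>z. \<Sum>n. ennreal ((cmod (a n))\<^sup>2) * ennreal (cmod z ^ (2 * n)))"
  have [measurable]: "G \<in> borel_measurable borel"
    unfolding G_def by measurable
  \<comment> \<open>The part of the weight living on the annulus where the modulus lies in [k,
    k+1).\<close>
  define v where "v = (\<lambda>k z. w z * indicator {z. nat \<lfloor>cmod z\<rfloor> = k} z)"
  have [measurable]: "v k \<in> borel_measurable borel" for k
    unfolding v_def by measurable
  have v_sum: "(\<Sum>k. v k z) = w z" for z
  proof -
    have "(\<Sum>k. v k z) = (\<Sum>k\<in>{nat \<lfloor>cmod z\<rfloor>}. v k z)"
      by (rule suminf_finite) (auto simp: v_def)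
    then show ?thesis by (simp add: v_def)
  qed
  have split: "(\<integral>\<^sup>+z. H z * w z \<partial>lborel) = (\<Sum>k. \<integral>\<^sup>+z. H z * v k z \<partial>lborel)"
    if [measurable]: "H \<in> borel_measurable borel" for H :: "complex \<Rightarrow> ennreal"
    by (subst nn_integral_suminf[symmetric]) (auto simp: v_sum ennreal_suminf_cmult)
  have G: "(\<integral>\<^sup>+z. G z * u z \<partial>lborel) = (\<Sum>n. ennreal ((cmod (a n))\<^sup>2) * (\<integral>\<^sup>+z. ennreal (cmod z ^ (2 * n)) * u z \<partial>lborel))"
    if [measurable]: "u \<in> borel_measurable borel" for u :: "complex \<Rightarrow> ennreal"
  proof -
    have "(\<integral>\<^sup>+z. (\<Sum>n. ennreal ((cmod (a n))\<^sup>2) * ennreal (cmod z ^ (2 * n))) * u z \<partial>lborel)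
      = (\<integral>\<^sup>+z. (\<Sum>n. ennreal ((cmod (a n))\<^sup>2) * (ennreal (cmod z ^ (2 * n)) * u z)) \<partial>lborel)"
      unfolding ennreal_suminf_multc[symmetric] mult.assoc ..
    also have "\<dots> = (\<Sum>n. \<integral>\<^sup>+z. ennreal ((cmod (a n))\<^sup>2) * (ennreal (cmod z ^ (2 * n)) * u z) \<partial>lborel)"
      by (rule nn_integral_suminf) measurable
    also have "\<dots> = (\<Sum>n. ennreal ((cmod (a n))\<^sup>2) * (\<integral>\<^sup>+z. ennreal (cmod z ^ (2 * n)) * u z \<partial>lborel))"
      by (intro suminf_cong nn_integral_cmult) measurable
    finally show ?thesis by (simp only: G_def)
  qed
  have eq: "(\<integral>\<^sup>+z. ennreal ((cmod (F z))\<^sup>2) * v k z \<partial>lborel) = (\<integral>\<^sup>+z. G z * v k z \<partial>lborel)" for k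
  proof (subst G, measurable, rule parseval_bounded_support[where R = "real (Suc k)"])
    show "v k (c * z) = v k z" if "cmod c = 1" for c z
      using that rad[of c z] by (auto simp: v_def norm_mult indicator_def)
    show "v k z = 0" if "cmod z > real (Suc k)" for z
      using that by (auto simp: v_def indicator_def) linarith
    have "(\<integral>\<^sup>+z. v k z \<partial>lborel) \<le> (\<integral>\<^sup>+z. w z \<partial>lborel)"
      by (intro nn_integral_mono) (auto simp: v_def indicator_def)
    then show "(\<integral>\<^sup>+z. v k z \<partial>lborel) < \<infinity>"
      using fin by (rule le_less_trans)
  qed (use F in auto)
  show ?thesis
    unfolding G[OF w, symmetric] by (simp add: split eq)
qed

section \<open>The integrals of cosh(alpha u) / cosh(u)^a\<close>

definition cosh_quot :: "real \<Rightarrow> real \<Rightarrow> real \<Rightarrow> real" where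
  "cosh_quot a \<alpha> u = cosh (\<alpha> * u) * cosh u powr - a"

text \<open>For |\<alpha>| < a, multiplication by \<open>Gamma a\<close> turns this into the Mellin
  transform of the Macdonald function, see \<open>nn_integral_powr_macdonald\<close>.\<close>

definition cosh_integral :: "real \<Rightarrow> real \<Rightarrow> real" where
  "cosh_integral a \<alpha> = (LINT u:{0..}|lborel. cosh_quot a \<alpha> u)"

lemma cosh_borel_measurable [measurable]: "(cosh :: real \<Rightarrow> real) \<in> borel_measurable borel"
  by (intro borel_measurable_continuous_onI continuous_intros)

lemma cosh_quot_measurable [measurable]: "cosh_quot a \<alpha> \<in> borel_measurable borel"
  unfolding cosh_quot_def by measurable

lemma cosh_quot_pos: "0 < cosh_quot a \<alpha> u"
  by (simp add: cosh_quot_def)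

lemma cosh_quot_nonneg [simp]: "0 \<le> cosh_quot a \<alpha> u"
  by (rule less_imp_le[OF cosh_quot_pos])

lemma cosh_mult_le_exp:
  fixes u :: real
  assumes "0 \<le> u"
  shows "cosh (\<alpha> * u) \<le> exp (\<bar>\<alpha>\<bar> * u)"
proof -
  have "exp (\<alpha> * u) \<le> exp (\<bar>\<alpha>\<bar> * u)" "exp (- (\<alpha> * u)) \<le> exp (\<bar>\<alpha>\<bar> * u)"
    using assms by (auto simp: abs_mult[symmetric] intro: abs_ge_minus_self mult_right_mono)
       (metis abs_ge_minus_self abs_mult abs_of_nonneg)
  then show ?thesis by (simp add: cosh_def del: exp_le_cancel_iff)
qed

text \<open>From cosh u \<ge> exp u / 2. The rate a - |\<alpha>| explains the condition |\<alpha>| <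
  a in the integrability statements below.\<close>

lemma cosh_quot_le:
  assumes "0 \<le> u" "0 \<le> a"
  shows "cosh_quot a \<alpha> u \<le> 2 powr a * exp (- (a - \<bar>\<alpha>\<bar>) * u)"
proof -
  have "exp u / 2 \<le> cosh u"
    by (simp add: cosh_def)
  then have "cosh u powr - a \<le> (exp u / 2) powr - a"
    using assms by (intro powr_mono2') auto
  also have "\<dots> = 2 powr a * exp (- (a * u))"
    by (simp add: powr_divide powr_minus_divide exp_powr_real exp_minus field_simps)
  finally have "cosh_quot a \<alpha> u \<le> exp (\<bar>\<alpha>\<bar> * u) * (2 powr a * exp (- (a * u)))"
    unfolding cosh_quot_def using assms by (intro mult_mono cosh_mult_le_exp) auto
  also have "\<dots> = 2 powr a * exp (- (a - \<bar>\<alpha>\<bar>) * u)"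
    by (simp add: algebra_simps flip: exp_add)
  finally show ?thesis .
qed

lemma set_integrable_exp_minus:
  fixes k :: real
  assumes "0 < k"
  shows "set_integrable lborel {0..} (\<lambda>u. exp (- k * u))"
proof -
  have "((\<lambda>u. - exp (- k * u) / k) \<longlongrightarrow> 0) at_top"
    using assms by real_asymp
  then have "(\<integral>\<^sup>+u. ennreal (exp (- k * u)) * indicator {0..} u \<partial>lborel) = ennreal (0 - (- exp (- k * 0) / k))"
    using assms
    by (intro nn_integral_FTC_atLeast[where F = "\<lambda>u. - exp (- k * u) / k"])
       (auto intro!: derivative_eq_intros)
  then show ?thesis
    unfolding set_integrable_def
    by (intro integrableI_nonneg) (auto simp: mult_ac ennreal_mult' ennreal_indicator)
qed

lemma cosh_quot_set_integrable:
  assumes "\<bar>\<alpha>\<bar> < a"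
  shows "set_integrable lborel {0..} (cosh_quot a \<alpha>)"
proof (rule set_integrable_bound)
  show "set_integrable lborel {0..} (\<lambda>u. 2 powr a * exp (- (a - \<bar>\<alpha>\<bar>) * u))"
    using assms by (intro set_integrable_mult_right set_integrable_exp_minus) auto
  show "set_borel_measurable lborel {0..} (cosh_quot a \<alpha>)"
    unfolding set_borel_measurable_def by measurable
  show "AE u in lborel. u \<in> {0..} \<longrightarrow> norm (cosh_quot a \<alpha> u) \<le> norm (2 powr a * exp (- (a - \<bar>\<alpha>\<bar>) * u))"
    using assms cosh_quot_le[of _ a \<alpha>] by (intro AE_I2) auto
qed

lemma cosh_integral_minus: "cosh_integral a (- \<alpha>) = cosh_integral a \<alpha>"
  by (simp add: cosh_integral_def cosh_quot_def)

lemma cosh_integral_nonneg: "0 \<le> cosh_integral a \<alpha>"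
  unfolding cosh_integral_def set_lebesgue_integral_def by (rule integral_nonneg_AE) auto

lemma cosh_integral_mono:
  assumes "\<bar>\<alpha>\<bar> < a" "\<bar>\<beta>\<bar> < b" "\<And>u. 0 \<le> u \<Longrightarrow> cosh_quot a \<alpha> u \<le> k * cosh_quot b \<beta> u"
  shows "cosh_integral a \<alpha> \<le> k * cosh_integral b \<beta>"
  unfolding cosh_integral_def
  by (subst set_integral_mult_right[symmetric], rule set_integral_mono)
     (use assms in \<open>auto intro!: cosh_quot_set_integrable set_integrable_mult_right\<close>)

text \<open>Integration of the derivative of sinh(\<alpha> u) / cosh(u)^b, whose boundary values
  vanish. The addition formula for cosh((\<alpha> - 1) u) identifies this derivative with the
  difference of the two integrands.\<close>

lemma cosh_integral_rec_minus:
  assumes "\<bar>\<alpha>\<bar> < b"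
  shows "b * cosh_integral (b + 1) (\<alpha> - 1) = (b - \<alpha>) * cosh_integral b \<alpha>"
proof -
  define f where "f = (\<lambda>u. b * cosh_quot (b + 1) (\<alpha> - 1) u - (b - \<alpha>) * cosh_quot b \<alpha> u)"
  define F where "F = (\<lambda>u::real. sinh (\<alpha> * u) * cosh u powr - b)"
  have b: "0 < b" using assms by linarith
  have [measurable]: "f \<in> borel_measurable borel"
    unfolding f_def by measurable
  have int: "set_integrable lborel {0..} (cosh_quot (b + 1) (\<alpha> - 1))" "set_integrable lborel {0..} (cosh_quot b \<alpha>)"
    using assms by (auto intro!: cosh_quot_set_integrable)
  have intf: "set_integrable lborel {0..} f"
    unfolding f_def using int by (intro set_integral_diff set_integrable_mult_right)
  have deriv: "(F has_real_derivative f u) (at u)" for u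
  proof -
    have e: "- 1 - b = - b - 1" by simp
    have c: "cosh u powr - b = cosh u * cosh u powr (- b - 1)"
      using powr_mult_base[of "cosh u" "- b - 1"] by simp
    have "(F has_real_derivative (\<alpha> * cosh (\<alpha> * u) * cosh u powr - b
        + sinh (\<alpha> * u) * (- b * cosh u powr (- b - 1) * sinh u))) (at u)"
      unfolding F_def by (auto intro!: derivative_eq_intros simp: powr_diff)
    moreover have "\<alpha> * cosh (\<alpha> * u) * cosh u powr - b
        + sinh (\<alpha> * u) * (- b * cosh u powr (- b - 1) * sinh u) = f u"
      unfolding f_def cosh_quot_def c
      by (simp add: left_diff_distrib cosh_diff e[symmetric]) (simp add: algebra_simps)
    ultimately show ?thesis by simp
  qed
  have cont: "isCont f u" for u
    unfolding f_def cosh_quot_def by (intro continuous_intros) auto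
  have "F 0 = 0" by (simp add: F_def)
  \<comment> \<open>The fundamental theorem is applied on an interval with \<open>ereal\<close>
    endpoints, so both boundary limits are phrased through \<open>real_of_ereal\<close>.\<close>
  have lim0: "((F \<circ> real_of_ereal) \<longlongrightarrow> 0) (at_right 0)"
    using DERIV_isCont[OF deriv, of 0] \<open>F 0 = 0\<close>
    by (simp add: zero_ereal_def ereal_tendsto_simps isCont_def filterlim_at_split)
  have bound: "eventually (\<lambda>u. norm (F u) \<le> 2 powr b * exp (- (b - \<bar>\<alpha>\<bar>) * u)) at_top"
    using eventually_ge_at_top[of 0]
  proof eventually_elim
    case (elim u)
    have "\<bar>sinh (\<alpha> * u)\<bar> \<le> cosh (\<alpha> * u)"
      by (simp add: sinh_def cosh_def abs_le_iff)
    then have "norm (F u) \<le> cosh_quot b \<alpha> u"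
      by (simp add: F_def cosh_quot_def abs_mult)
    also note cosh_quot_le[OF elim less_imp_le[OF b]]
    finally show ?case .
  qed
  have "((\<lambda>u. 2 powr b * exp (- (b - \<bar>\<alpha>\<bar>) * u)) \<longlongrightarrow> 0) at_top"
  proof -
    define k where "k = b - \<bar>\<alpha>\<bar>"
    have "k > 0" using assms by (simp add: k_def)
    then show ?thesis unfolding k_def[symmetric] by real_asymp
  qed
  then have "(F \<longlongrightarrow> 0) at_top"
    using Lim_null_comparison[OF bound] by simp
  then have lim1: "((F \<circ> real_of_ereal) \<longlongrightarrow> 0) (at_left \<infinity>)"
    by (simp add: ereal_tendsto_simps)
  have "(LBINT u=0..\<infinity>. f u) = 0 - 0"
  proof (rule interval_integral_FTC_integrable[where F = F])
    show "set_integrable lborel (einterval 0 \<infinity>) f"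
      by (rule set_integrable_subset[OF intf]) (auto simp: einterval_def)
  qed (use deriv cont lim0 lim1 in \<open>auto simp: has_real_derivative_iff_has_vector_derivative\<close>)
  moreover have "(LBINT u=0..\<infinity>. f u) = (LINT u:{0<..}|lborel. f u)"
    by (simp add: zero_ereal_def interval_integral_to_infinity_eq)
  \<comment> \<open>The interval integral lives on the open half-line, \<open>cosh_integral\<close>
    on the closed one; they differ by a null set.\<close>
  moreover have "(LINT u:{0<..}|lborel. f u) = (LINT u:{0..}|lborel. f u)"
    unfolding set_lebesgue_integral_def
  proof (rule integral_cong_AE)
    show "AE u in lborel. indicator {0<..} u *\<^sub>R f u = indicator {0..} u *\<^sub>R f u"
      using AE_lborel_singleton[of 0] by eventually_elim (auto simp: indicator_def)
  qed measurable
  moreover have "(LINT u:{0..}|lborel. f u) = b * cosh_integral (b + 1) (\<alpha> - 1) - (b - \<alpha>) * cosh_integral b \<alpha>"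
    unfolding f_def cosh_integral_def using set_integral_diff(2)[OF set_integrable_mult_right set_integrable_mult_right] int
    by simp
  ultimately show ?thesis by simp
qed

text \<open>The integrals are even in \<alpha>, so this is the previous recurrence at
  -\<alpha>.\<close>

lemma cosh_integral_rec_plus:
  assumes "\<bar>\<alpha>\<bar> < b"
  shows "b * cosh_integral (b + 1) (\<alpha> + 1) = (b + \<alpha>) * cosh_integral b \<alpha>"
  using cosh_integral_rec_minus[of "- \<alpha>" b] assms cosh_integral_minus[of "b + 1" "\<alpha> + 1"]
  by (simp add: cosh_integral_minus)

section \<open>Moments of the Macdonald densities\<close>

lemma nn_set_integral_eq_set_integral:
  fixes f :: "'a \<Rightarrow> real"
  assumes "set_integrable M A f" "\<And>x. 0 \<le> f x"
  shows "(\<integral>\<^sup>+x\<in>A. ennreal (f x) \<partial>M) = ennreal (LINT x:A|M. f x)"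
proof -
  have "(\<integral>\<^sup>+x\<in>A. ennreal (f x) \<partial>M) = (\<integral>\<^sup>+x. ennreal (indicator A x *\<^sub>R f x) \<partial>M)"
    by (intro nn_integral_cong) (auto simp: indicator_def)
  also have "\<dots> = ennreal (LINT x:A|M. f x)"
    using assms unfolding set_integrable_def set_lebesgue_integral_def
    by (intro nn_integral_eq_integral) auto
  finally show ?thesis .
qed

lemma macdonald_measurable [measurable]: "macdonald \<alpha> \<in> borel_measurable borel"
  unfolding macdonald_def set_lebesgue_integral_def by measurable

lemma macdonald_nonneg: "0 \<le> macdonald \<alpha> x"
  unfolding macdonald_def set_lebesgue_integral_def by (rule integral_nonneg_AE) auto

text \<open>The inequality exp y \<ge> (1 + y/n)^n \<ge> (y/n)^n at y = x cosh u bounds the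
  integrand by a multiple of \<open>cosh_quot n \<alpha>\<close>, which is integrable once n >
  |\<alpha>|.\<close>

lemma macdonald_set_integrable:
  fixes x \<alpha> :: real
  assumes "0 < x"
  shows "set_integrable lborel {0..} (\<lambda>u. exp (- x * cosh u) * cosh (\<alpha> * u))"
proof (rule set_integrable_bound)
  define n where "n = Suc (nat \<lceil>\<bar>\<alpha>\<bar>\<rceil>)"
  have n: "\<bar>\<alpha>\<bar> < real n" "0 < n"
    unfolding n_def by linarith+
  define C where "C = (real n / x) ^ n"
  show "set_integrable lborel {0..} (\<lambda>u. C * cosh_quot (real n) \<alpha> u)"
    using n by (intro set_integrable_mult_right cosh_quot_set_integrable)
  show "set_borel_measurable lborel {0..} (\<lambda>u. exp (- x * cosh u) * cosh (\<alpha> * u))"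
    unfolding set_borel_measurable_def by measurable
  have "exp (- x * cosh u) * cosh (\<alpha> * u) \<le> C * cosh_quot (real n) \<alpha> u" for u :: real
  proof -
    let ?y = "x * cosh u"
    have y: "0 < ?y" using assms by simp
    have "(?y / real n) ^ n \<le> (1 + ?y / real n) ^ n"
      using y by (intro power_mono) auto
    also have "\<dots> \<le> exp ?y"
      using y n by (intro exp_ge_one_plus_x_over_n_power_n) auto
    finally have "inverse (exp ?y) \<le> inverse ((?y / real n) ^ n)"
      using y n by (intro le_imp_inverse_le zero_less_power) auto
    then have "exp (- ?y) \<le> (real n / ?y) ^ n"
      by (simp only: exp_minus power_inverse[symmetric] inverse_divide)
    also have "\<dots> = C * cosh u powr - real n"
      using assms by (simp add: C_def powr_minus_divide powr_realpow power_mult_distrib field_simps)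
    finally show ?thesis
      by (simp add: cosh_quot_def mult.assoc mult_left_mono mult_right_mono flip: mult.assoc)
  qed
  moreover have "0 \<le> C" using assms by (simp add: C_def)
  ultimately show "AE u in lborel. u \<in> {0..} \<longrightarrow> norm (exp (- x * cosh u) * cosh (\<alpha> * u)) \<le> norm (C * cosh_quot (real n) \<alpha> u)"
    by (intro AE_I2) (simp add: abs_mult)
qed

lemma ennreal_macdonald:
  assumes "0 < x"
  shows "ennreal (macdonald \<alpha> x) = (\<integral>\<^sup>+u\<in>{0..}. ennreal (exp (- x * cosh u) * cosh (\<alpha> * u)) \<partial>lborel)"
  unfolding macdonald_def using macdonald_set_integrable[OF assms, of \<alpha>]
  by (subst nn_set_integral_eq_set_integral) auto

text \<open>Euler's Gamma integral after the substitution t = y s.\<close>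

lemma nn_integral_powr_exp:
  fixes a y :: real
  assumes "0 < a" "0 < y"
  shows "(\<integral>\<^sup>+s\<in>{0..}. ennreal (s powr (a - 1) * exp (- s * y)) \<partial>lborel) = ennreal (Gamma a * y powr - a)"
proof -
  let ?I = "\<integral>\<^sup>+s\<in>{0..}. ennreal (s powr (a - 1) * exp (- s * y)) \<partial>lborel"
  have "ennreal (Gamma a) = (\<integral>\<^sup>+t. ennreal (indicator {0..} t * t powr (a - 1) / exp t) \<partial>lborel)"
    using Gamma_conv_nn_integral_real[OF assms(1)] .
  also have "\<dots> = ennreal \<bar>y\<bar> * (\<integral>\<^sup>+s. ennreal (indicator {0..} (0 + y * s) * (0 + y * s) powr (a - 1) / exp (0 + y * s)) \<partial>lborel)"
    using assms by (intro nn_integral_real_affine) auto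
  also have "(\<integral>\<^sup>+s. ennreal (indicator {0..} (0 + y * s) * (0 + y * s) powr (a - 1) / exp (0 + y * s)) \<partial>lborel)
     = (\<integral>\<^sup>+s. ennreal (y powr (a - 1)) * (ennreal (s powr (a - 1) * exp (- s * y)) * indicator {0..} s) \<partial>lborel)"
    using assms
    by (intro nn_integral_cong)
       (auto simp: indicator_def powr_mult exp_minus field_simps zero_le_mult_iff simp flip: ennreal_mult')
  also have "\<dots> = ennreal (y powr (a - 1)) * ?I"
    by (intro nn_integral_cmult) measurable
  finally have *: "ennreal (Gamma a) = ennreal (y powr a) * ?I"
    using assms powr_mult_base[of y "a - 1"] by (simp add: mult.assoc[symmetric] ennreal_mult'[symmetric])
  have "ennreal (Gamma a * y powr - a) = ennreal (y powr - a) * ennreal (Gamma a)"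
    using assms by (simp add: ennreal_mult' mult.commute)
  also have "\<dots> = ennreal (y powr - a * y powr a) * ?I"
    by (simp only: * mult.assoc[symmetric] ennreal_mult'[OF powr_ge_zero])
  also have "y powr - a * y powr a = 1"
    using assms by (simp flip: powr_add)
  finally show ?thesis by simp
qed

text \<open>After inserting the integral for the Macdonald function and exchanging the order by
  Tonelli, the inner integral is a Gamma integral with y = cosh u.\<close>

lemma nn_integral_powr_macdonald:
  assumes "\<bar>\<alpha>\<bar> < a"
  shows "(\<integral>\<^sup>+s\<in>{0..}. ennreal (s powr (a - 1) * macdonald \<alpha> s) \<partial>lborel) = ennreal (Gamma a * cosh_integral a \<alpha>)"
proof -
  have a: "0 < a" using assms by linarith
  let ?f = "\<lambda>s u. ennreal (s powr (a - 1) * exp (- s * cosh u)) * indicator {0..} s * (ennreal (cosh (\<alpha> * u)) * indicator {0..} u)"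
  have "(\<integral>\<^sup>+s\<in>{0..}. ennreal (s powr (a - 1) * macdonald \<alpha> s) \<partial>lborel)
      = (\<integral>\<^sup>+s. \<integral>\<^sup>+u. ?f s u \<partial>lborel \<partial>lborel)"
  \<comment> \<open>The integral representation is available only for positive arguments; the point
    0 is a null set.\<close>
  proof (rule nn_integral_cong_AE, use AE_lborel_singleton[of "0::real"] in eventually_elim)
    fix s :: real assume s: "s \<noteq> 0"
    show "ennreal (s powr (a - 1) * macdonald \<alpha> s) * indicator {0..} s = (\<integral>\<^sup>+u. ?f s u \<partial>lborel)"
    proof (cases "0 < s")
      case True
      have "ennreal (s powr (a - 1) * macdonald \<alpha> s)
        = ennreal (s powr (a - 1)) * (\<integral>\<^sup>+u\<in>{0..}. ennreal (exp (- s * cosh u) * cosh (\<alpha> * u)) \<partial>lborel)"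
        using True by (simp only: ennreal_mult'[OF powr_ge_zero] ennreal_macdonald)
      also have "\<dots> = (\<integral>\<^sup>+u. ennreal (s powr (a - 1)) * (ennreal (exp (- s * cosh u) * cosh (\<alpha> * u)) * indicator {0..} u) \<partial>lborel)"
        by (rule nn_integral_cmult[symmetric]) measurable
      also have "\<dots> = (\<integral>\<^sup>+u. ?f s u \<partial>lborel)"
        using True by (intro nn_integral_cong) (simp add: ennreal_mult' mult_ac)
      finally show ?thesis using True by simp
    qed (use s in auto)
  qed
  also have "\<dots> = (\<integral>\<^sup>+u. \<integral>\<^sup>+s. ?f s u \<partial>lborel \<partial>lborel)"
    by (rule lborel_pair.Fubini') measurable
  also have "\<dots> = (\<integral>\<^sup>+u. ennreal (Gamma a) * (ennreal (cosh_quot a \<alpha> u) * indicator {0..} u) \<partial>lborel)"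
  proof (rule nn_integral_cong)
    fix u :: real
    have "(\<integral>\<^sup>+s. ?f s u \<partial>lborel) = (\<integral>\<^sup>+s\<in>{0..}. ennreal (s powr (a - 1) * exp (- s * cosh u)) \<partial>lborel) * (ennreal (cosh (\<alpha> * u)) * indicator {0..} u)"
      by (rule nn_integral_multc) measurable
    also have "(\<integral>\<^sup>+s\<in>{0..}. ennreal (s powr (a - 1) * exp (- s * cosh u)) \<partial>lborel) = ennreal (Gamma a * cosh u powr - a)"
      using a by (intro nn_integral_powr_exp) auto
    finally show "(\<integral>\<^sup>+s. ?f s u \<partial>lborel) = ennreal (Gamma a) * (ennreal (cosh_quot a \<alpha> u) * indicator {0..} u)"
      using a by (simp add: cosh_quot_def Gamma_real_pos less_imp_le ennreal_mult' mult_ac)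
  qed
  also have "\<dots> = ennreal (Gamma a) * (\<integral>\<^sup>+u\<in>{0..}. ennreal (cosh_quot a \<alpha> u) \<partial>lborel)"
    by (rule nn_integral_cmult) measurable
  also have "(\<integral>\<^sup>+u\<in>{0..}. ennreal (cosh_quot a \<alpha> u) \<partial>lborel) = ennreal (cosh_integral a \<alpha>)"
    unfolding cosh_integral_def using cosh_quot_set_integrable[OF assms]
    by (intro nn_set_integral_eq_set_integral) auto
  finally show ?thesis
    using a by (simp add: ennreal_mult' Gamma_real_pos less_imp_le)
qed

text \<open>Since cosh u \<ge> 1, the factor exp(\<delta> s) is absorbed by part of exp(-s cosh u).
  This expresses the decay like exp(-s).\<close>

lemma exp_mult_macdonald_le:
  assumes "0 < s" "0 \<le> \<delta>" "\<delta> < 1"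
  shows "exp (\<delta> * s) * macdonald \<alpha> s \<le> macdonald \<alpha> ((1 - \<delta>) * s)"
  unfolding macdonald_def
proof (subst set_integral_mult_right[symmetric], rule set_integral_mono)
  show "set_integrable lborel {0..} (\<lambda>u. exp (\<delta> * s) * (exp (- s * cosh u) * cosh (\<alpha> * u)))"
    using assms by (intro set_integrable_mult_right macdonald_set_integrable)
  show "set_integrable lborel {0..} (\<lambda>u. exp (- ((1 - \<delta>) * s) * cosh u) * cosh (\<alpha> * u))"
    using assms by (intro macdonald_set_integrable) auto
  fix u :: real
  have "\<delta> * s \<le> \<delta> * (s * cosh u)"
    using assms cosh_real_ge_1[of u] by (intro mult_left_mono) auto
  then have "exp (\<delta> * s) * exp (- s * cosh u) \<le> exp (- ((1 - \<delta>) * s) * cosh u)"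
    by (simp add: algebra_simps flip: exp_add)
  then show "exp (\<delta> * s) * (exp (- s * cosh u) * cosh (\<alpha> * u)) \<le> exp (- ((1 - \<delta>) * s) * cosh u) * cosh (\<alpha> * u)"
    by (simp add: mult_right_mono flip: mult.assoc)
qed

text \<open>The preceding bound and the scaling s to (1 - \<delta>) s reduce the claim to the finite
  Mellin transform.\<close>

lemma nn_integral_powr_exp_macdonald_finite:
  assumes "\<bar>\<alpha>\<bar> < a" "0 \<le> \<delta>" "\<delta> < 1"
  shows "(\<integral>\<^sup>+s\<in>{0..}. ennreal (s powr (a - 1) * (exp (\<delta> * s) * macdonald \<alpha> s)) \<partial>lborel) < \<infinity>"
proof -
  define y where "y = 1 - \<delta>"
  have y: "0 < y" using assms by (simp add: y_def)
  have "(\<integral>\<^sup>+s\<in>{0..}. ennreal (s powr (a - 1) * (exp (\<delta> * s) * macdonald \<alpha> s)) \<partial>lborel)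
     \<le> (\<integral>\<^sup>+s\<in>{0..}. ennreal (s powr (a - 1) * macdonald \<alpha> (y * s)) \<partial>lborel)" (is "_ \<le> ?I")
    using assms exp_mult_macdonald_le[OF _ assms(2,3)] unfolding y_def
    by (intro nn_integral_mono_AE AE_mp[OF AE_lborel_singleton[of 0] AE_I2])
       (auto simp: indicator_def intro!: ennreal_leI mult_left_mono)
  also have "?I < \<infinity>"
  proof -
    have "ennreal (Gamma a * cosh_integral a \<alpha>) = (\<integral>\<^sup>+s\<in>{0..}. ennreal (s powr (a - 1) * macdonald \<alpha> s) \<partial>lborel)"
      by (rule nn_integral_powr_macdonald[OF assms(1), symmetric])
    also have "\<dots> = ennreal \<bar>y\<bar> * (\<integral>\<^sup>+s. ennreal ((0 + y * s) powr (a - 1) * macdonald \<alpha> (0 + y * s)) * indicator {0..} (0 + y * s) \<partial>lborel)"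
      using y by (intro nn_integral_real_affine) auto
    also have "(\<integral>\<^sup>+s. ennreal ((0 + y * s) powr (a - 1) * macdonald \<alpha> (0 + y * s)) * indicator {0..} (0 + y * s) \<partial>lborel)
      = (\<integral>\<^sup>+s. ennreal (y powr (a - 1)) * (ennreal (s powr (a - 1) * macdonald \<alpha> (y * s)) * indicator {0..} s) \<partial>lborel)"
      using y by (intro nn_integral_cong)
        (auto simp: indicator_def powr_mult zero_le_mult_iff mult_ac simp flip: ennreal_mult')
    also have "\<dots> = ennreal (y powr (a - 1)) * ?I"
      by (rule nn_integral_cmult) measurable
    finally have "ennreal \<bar>y\<bar> * (ennreal (y powr (a - 1)) * ?I) < \<infinity>"
      by (metis ennreal_less_top infinity_ennreal_def)
    then show ?thesis
      using y by (auto simp: ennreal_mult_less_top)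
  qed
  finally show ?thesis .
qed

section \<open>The two densities and their moments\<close>

text \<open>A free index treats both measures at once: \<mu> - 1/2 gives the even density and \<mu>
  + 1/2 the odd one.\<close>

definition macdonald_weight :: "real \<Rightarrow> real \<Rightarrow> complex \<Rightarrow> real" where
  "macdonald_weight \<mu> \<alpha> z = 2 powr (1/2 - \<mu>) / (pi * Gamma (\<mu> + 1/2))
     * macdonald \<alpha> ((cmod z)\<^sup>2) * cmod z powr (2 * \<mu> + 1)"

lemma nu_e_eq_macdonald_weight: "nu_e \<mu> = density lborel (\<lambda>z. ennreal (macdonald_weight \<mu> (\<mu> - 1/2) z))"
  by (simp add: nu_e_def nu_e_density_def macdonald_weight_def)

lemma nu_o_eq_macdonald_weight: "nu_o \<mu> = density lborel (\<lambda>z. ennreal (macdonald_weight \<mu> (\<mu> + 1/2) z))"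
  by (simp add: nu_o_def nu_o_density_def macdonald_weight_def)

lemma macdonald_weight_measurable [measurable]: "macdonald_weight \<mu> \<alpha> \<in> borel_measurable borel"
  unfolding macdonald_weight_def by measurable

text \<open>Closed form of the integral of |z|^(2n) against the weight. With s = |z|^2 the integrand
  is s^(n + \<mu> + 1/2) times the Macdonald function, whence the Mellin parameter n + \<mu> + 3/2;
  the area factor pi cancels the one in the density.\<close>

definition macdonald_moment :: "real \<Rightarrow> real \<Rightarrow> nat \<Rightarrow> real" where
  "macdonald_moment \<mu> \<alpha> n = 2 powr (1/2 - \<mu>) / Gamma (\<mu> + 1/2)
     * (Gamma (n + \<mu> + 3/2) * cosh_integral (n + \<mu> + 3/2) \<alpha>)"

lemma nn_integral_macdonald_weight:
  assumes "0 \<le> \<mu>" and [measurable]: "h \<in> borel_measurable borel" and h: "\<And>s. 0 \<le> s \<Longrightarrow> 0 \<le> h s"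
  shows "(\<integral>\<^sup>+z. ennreal (h ((cmod z)\<^sup>2)) * ennreal (macdonald_weight \<mu> \<alpha> z) \<partial>lborel)
    = ennreal (2 powr (1/2 - \<mu>) / Gamma (\<mu> + 1/2)) *
      (\<integral>\<^sup>+s\<in>{0..}. ennreal (s powr (\<mu> + 1/2) * (h s * macdonald \<alpha> s)) \<partial>lborel)"
proof -
  define \<kappa> where "\<kappa> = 2 powr (1/2 - \<mu>) / (pi * Gamma (\<mu> + 1/2))"
  have \<kappa>: "0 \<le> \<kappa>"
    using assms by (simp add: \<kappa>_def Gamma_real_pos less_imp_le)
  have pw: "cmod z powr (2 * \<mu> + 1) = (cmod z)\<^sup>2 powr (\<mu> + 1/2)" for z
    by (cases "z = 0") (simp_all add: powr_powr algebra_simps flip: powr_numeral)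
  have "(\<integral>\<^sup>+z. ennreal (h ((cmod z)\<^sup>2)) * ennreal (macdonald_weight \<mu> \<alpha> z) \<partial>lborel)
     = (\<integral>\<^sup>+z. ennreal \<kappa> * ennreal ((cmod z)\<^sup>2 powr (\<mu> + 1/2) * (h ((cmod z)\<^sup>2) * macdonald \<alpha> ((cmod z)\<^sup>2))) \<partial>lborel)"
    using \<kappa> h by (intro nn_integral_cong)
      (simp add: macdonald_weight_def pw \<kappa>_def[symmetric] mult_ac macdonald_nonneg pw[simplified mult.commute[of 2]] flip: ennreal_mult')
  also have "\<dots> = ennreal pi * (\<integral>\<^sup>+s\<in>{0..}. (ennreal \<kappa> * ennreal (s powr (\<mu> + 1/2) * (h s * macdonald \<alpha> s))) \<partial>lborel)"
    by (rule nn_integral_lborel_complex_radial) measurable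
  also have "\<dots> = ennreal pi * (ennreal \<kappa> * (\<integral>\<^sup>+s\<in>{0..}. ennreal (s powr (\<mu> + 1/2) * (h s * macdonald \<alpha> s)) \<partial>lborel))"
    by (subst nn_integral_cmult[symmetric]) (auto simp: mult.assoc)
  also have "\<dots> = ennreal (pi * \<kappa>) * (\<integral>\<^sup>+s\<in>{0..}. ennreal (s powr (\<mu> + 1/2) * (h s * macdonald \<alpha> s)) \<partial>lborel)"
    using \<kappa> by (simp add: ennreal_mult' mult.assoc)
  also have "pi * \<kappa> = 2 powr (1/2 - \<mu>) / Gamma (\<mu> + 1/2)"
    by (simp add: \<kappa>_def)
  finally show ?thesis .
qed

lemma nn_integral_macdonald_weight_power:
  assumes "0 \<le> \<mu>" "\<bar>\<alpha>\<bar> < \<mu> + 3/2"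
  shows "(\<integral>\<^sup>+z. ennreal (cmod z ^ (2 * n)) * ennreal (macdonald_weight \<mu> \<alpha> z) \<partial>lborel)
    = ennreal (macdonald_moment \<mu> \<alpha> n)"
proof -
  have "(\<integral>\<^sup>+z. ennreal (cmod z ^ (2 * n)) * ennreal (macdonald_weight \<mu> \<alpha> z) \<partial>lborel)
    = ennreal (2 powr (1/2 - \<mu>) / Gamma (\<mu> + 1/2)) *
      (\<integral>\<^sup>+s\<in>{0..}. ennreal (s powr (\<mu> + 1/2) * (s ^ n * macdonald \<alpha> s)) \<partial>lborel)"
    using nn_integral_macdonald_weight[OF assms(1), of "\<lambda>s. s ^ n" \<alpha>] by (simp add: power_mult)
  also have "(\<integral>\<^sup>+s\<in>{0..}. ennreal (s powr (\<mu> + 1/2) * (s ^ n * macdonald \<alpha> s)) \<partial>lborel)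
     = (\<integral>\<^sup>+s\<in>{0..}. ennreal (s powr (n + \<mu> + 3/2 - 1) * macdonald \<alpha> s) \<partial>lborel)"
  proof (intro nn_integral_cong)
    fix s :: real
    have "s powr (\<mu> + 1/2) * s ^ n = s powr (n + \<mu> + 3/2 - 1)" if "s > 0"
      using that by (simp add: powr_realpow[symmetric] powr_add[symmetric] algebra_simps)
    then have "s powr (\<mu> + 1/2) * s ^ n = s powr (n + \<mu> + 3/2 - 1)" if "s \<ge> 0"
      using that by (cases "s = 0") auto
    then show "ennreal (s powr (\<mu> + 1/2) * (s ^ n * macdonald \<alpha> s)) * indicator {0..} s
      = ennreal (s powr (n + \<mu> + 3/2 - 1) * macdonald \<alpha> s) * indicator {0..} s"
      by (auto simp: indicator_def mult.assoc[symmetric])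
  qed
  also have "\<dots> = ennreal (Gamma (n + \<mu> + 3/2) * cosh_integral (n + \<mu> + 3/2) \<alpha>)"
    using assms by (intro nn_integral_powr_macdonald) auto
  finally show ?thesis
    unfolding macdonald_moment_def using assms by (subst ennreal_mult') (simp_all add: Gamma_real_pos less_imp_le)
qed

lemma nn_integral_macdonald_weight_exp_finite:
  assumes "0 \<le> \<mu>" "\<bar>\<alpha>\<bar> < \<mu> + 3/2" "0 \<le> \<delta>" "\<delta> < 1"
  shows "(\<integral>\<^sup>+z. ennreal (exp (\<delta> * (cmod z)\<^sup>2)) * ennreal (macdonald_weight \<mu> \<alpha> z) \<partial>lborel) < \<infinity>"
  using nn_integral_macdonald_weight[OF assms(1), of "\<lambda>s. exp (\<delta> * s)" \<alpha>]
    nn_integral_powr_exp_macdonald_finite[OF assms(2-4)]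
  by (simp add: ennreal_mult_less_top add.commute)

lemma macdonald_moment_nonneg:
  assumes "0 \<le> \<mu>"
  shows "0 \<le> macdonald_moment \<mu> \<alpha> n"
  unfolding macdonald_moment_def using assms
  by (intro mult_nonneg_nonneg divide_nonneg_nonneg cosh_integral_nonneg) (auto intro!: less_imp_le Gamma_real_pos)

text \<open>The relation Gamma(a + 1) = a Gamma(a) at a = n + \<mu> + 3/2 supplies the factor a in
  the recurrences for \<open>cosh_integral\<close>. Then a + (\<mu> - 1/2) = n + 1 + 2\<mu> and a -
  (\<mu> + 1/2) = n + 1.\<close>

lemma
  assumes "0 \<le> \<mu>"
  shows macdonald_moment_Suc_plus:
      "macdonald_moment \<mu> (\<mu> + 1/2) (Suc n) = (real n + 1 + 2 * \<mu>) * macdonald_moment \<mu> (\<mu> - 1/2) n"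
    and macdonald_moment_Suc_minus:
      "macdonald_moment \<mu> (\<mu> - 1/2) (Suc n) = (real n + 1) * macdonald_moment \<mu> (\<mu> + 1/2) n"
proof -
  define a where "a = real n + \<mu> + 3/2"
  have a: "0 < a" "real (Suc n) + \<mu> + 3/2 = a + 1"
    using assms by (auto simp: a_def)
  have G: "Gamma (a + 1) = a * Gamma a"
    using a by (intro Gamma_plus1) (auto simp: nonpos_Ints_def)
  have "a * cosh_integral (a + 1) (\<mu> + 1/2) = (real n + 1 + 2 * \<mu>) * cosh_integral a (\<mu> - 1/2)"
    using cosh_integral_rec_plus[of "\<mu> - 1/2" a] assms by (simp add: a_def algebra_simps)
  then show "macdonald_moment \<mu> (\<mu> + 1/2) (Suc n) = (real n + 1 + 2 * \<mu>) * macdonald_moment \<mu> (\<mu> - 1/2) n"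
    unfolding macdonald_moment_def a(2) a_def[symmetric] G by (simp add: mult_ac)
  have "a * cosh_integral (a + 1) (\<mu> - 1/2) = (real n + 1) * cosh_integral a (\<mu> + 1/2)"
    using cosh_integral_rec_minus[of "\<mu> + 1/2" a] assms by (simp add: a_def algebra_simps)
  then show "macdonald_moment \<mu> (\<mu> - 1/2) (Suc n) = (real n + 1) * macdonald_moment \<mu> (\<mu> + 1/2) n"
    unfolding macdonald_moment_def a(2) a_def[symmetric] G by (simp add: mult_ac)
qed

text \<open>The function cosh increases with the modulus of its argument, and |\<mu> - 1/2| \<le>
  \<mu> + 1/2 for nonnegative \<mu>.\<close>

lemma macdonald_moment_mono:
  assumes "0 \<le> \<mu>"
  shows "macdonald_moment \<mu> (\<mu> - 1/2) n \<le> macdonald_moment \<mu> (\<mu> + 1/2) n"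
proof -
  have "cosh ((\<mu> - 1/2) * u) \<le> cosh ((\<mu> + 1/2) * u)" if "0 \<le> u" for u
  proof -
    have "\<bar>(\<mu> - 1/2) * u\<bar> \<le> (\<mu> + 1/2) * u"
      using that assms by (simp add: abs_mult mult_right_mono)
    then have "cosh \<bar>(\<mu> - 1/2) * u\<bar> \<le> cosh ((\<mu> + 1/2) * u)"
      by (subst cosh_real_nonneg_le_iff) auto
    then show ?thesis by simp
  qed
  then have "cosh_integral (n + \<mu> + 3/2) (\<mu> - 1/2) \<le> 1 * cosh_integral (n + \<mu> + 3/2) (\<mu> + 1/2)"
    using assms by (intro cosh_integral_mono) (auto simp: cosh_quot_def intro!: mult_right_mono)
  then show ?thesis
    unfolding macdonald_moment_def using assms
    by (intro mult_left_mono) (auto intro!: divide_nonneg_nonneg less_imp_le Gamma_real_pos)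
qed

text \<open>With p and q for the even and odd moments, q(n+1) = (n+1+2\<mu>) p(n) \<le>
  (1+2\<mu>)(n+1) q(n) = (1+2\<mu>) p(n+1). Indices from 1 on suffice, since the energies involve
  only these.\<close>

lemma macdonald_moment_plus_le_minus:
  assumes "0 \<le> \<mu>"
  shows "macdonald_moment \<mu> (\<mu> + 1/2) (Suc n) \<le> (1 + 2 * \<mu>) * macdonald_moment \<mu> (\<mu> - 1/2) (Suc n)"
proof -
  have "(real n + 1 + 2 * \<mu>) * macdonald_moment \<mu> (\<mu> - 1/2) n
      \<le> ((1 + 2 * \<mu>) * (real n + 1)) * macdonald_moment \<mu> (\<mu> + 1/2) n"
    using assms by (intro mult_mono macdonald_moment_mono macdonald_moment_nonneg) (auto simp: algebra_simps)
  then show ?thesis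
    unfolding macdonald_moment_Suc_plus[OF assms] macdonald_moment_Suc_minus[OF assms] by (simp add: mult.assoc)
qed

section \<open>Power series of the Dunkl derivative\<close>

lemma entire_power_series:
  assumes "f holomorphic_on UNIV"
  obtains a :: "nat \<Rightarrow> complex" where "\<And>z. (\<lambda>n. a n * z ^ n) sums f z"
proof
  fix z
  show "(\<lambda>n. (deriv ^^ n) f 0 / fact n * z ^ n) sums f z"
    using holomorphic_power_series[of f 0 "cmod z + 1" z] assms holomorphic_on_subset by fastforce
qed

lemma powser_everywhere_has_derivative:
  fixes a :: "nat \<Rightarrow> complex"
  assumes F: "\<And>z. (\<lambda>n. a n * z ^ n) sums F z"
  shows "(\<lambda>n. diffs a n * z ^ n) sums deriv F z" "F holomorphic_on UNIV"
proof -
  have summ: "summable (\<lambda>n. a n * z ^ n)" for z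
    using F by (rule sums_summable)
  have eq: "F = (\<lambda>z. \<Sum>n. a n * z ^ n)"
    using F by (auto simp: sums_iff)
  have der: "(F has_field_derivative (\<Sum>n. diffs a n * z ^ n)) (at z)" for z
    unfolding eq by (rule termdiffs_strong_converges_everywhere[OF summ])
  have "summable (\<lambda>n. diffs a n * z ^ n)"
    by (rule termdiff_converges_all[OF summ])
  then show "(\<lambda>n. diffs a n * z ^ n) sums deriv F z"
    using DERIV_imp_deriv[OF der, of z] by (simp add: sums_iff)
  show "F holomorphic_on UNIV"
    using der by (auto simp: holomorphic_on_open)
qed

lemma even_part_sums:
  fixes a :: "nat \<Rightarrow> complex"
  assumes "\<And>z. (\<lambda>n. a n * z ^ n) sums F z"
  shows "(\<lambda>n. (if even n then a n else 0) * z ^ n) sums even_part F z"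
proof -
  have "(\<lambda>n. (a n * z ^ n + a n * (- z) ^ n) / 2) sums even_part F z"
    unfolding even_part_def by (intro sums_divide sums_add assms)
  also have "(\<lambda>n. (a n * z ^ n + a n * (- z) ^ n) / 2) = (\<lambda>n. (if even n then a n else 0) * z ^ n)"
    by (auto simp: fun_eq_iff)
  finally show ?thesis .
qed

lemma odd_part_sums:
  fixes a :: "nat \<Rightarrow> complex"
  assumes "\<And>z. (\<lambda>n. a n * z ^ n) sums F z"
  shows "(\<lambda>n. (if odd n then a n else 0) * z ^ n) sums odd_part F z"
proof -
  have "(\<lambda>n. (a n * z ^ n - a n * (- z) ^ n) / 2) sums odd_part F z"
    unfolding odd_part_def by (intro sums_divide sums_diff assms)
  also have "(\<lambda>n. (a n * z ^ n - a n * (- z) ^ n) / 2) = (\<lambda>n. (if odd n then a n else 0) * z ^ n)"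
    by (auto simp: fun_eq_iff)
  finally show ?thesis .
qed

text \<open>The eigenvalue-like factor by which \<open>D \<mu>\<close> sends z^n to a multiple of
  z^(n-1); the reflection term sees only odd powers.\<close>

definition dunkl_coeff :: "real \<Rightarrow> nat \<Rightarrow> real" where
  "dunkl_coeff \<mu> n = n + (if odd n then 2 * \<mu> else 0)"

lemma D_sums:
  fixes a :: "nat \<Rightarrow> complex"
  assumes F: "\<And>z. (\<lambda>n. a n * z ^ n) sums F z"
  shows "(\<lambda>n. (of_real (dunkl_coeff \<mu> (Suc n)) * a (Suc n)) * z ^ n) sums D \<mu> F z"
proof (cases "z = 0")
  case True
  note F' = powser_everywhere_has_derivative[OF F]
  have "deriv F 0 = a 1"
    using sums_unique2[OF F'(1)[of 0] powser_sums_zero] by (simp add: diffs_def)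
  then have "D \<mu> F 0 = of_real (dunkl_coeff \<mu> (Suc 0)) * a (Suc 0)"
    using D_zero[OF F'(2)] by (simp add: dunkl_coeff_def)
  then show ?thesis
    using True powser_sums_zero[of "\<lambda>n. of_real (dunkl_coeff \<mu> (Suc n)) * a (Suc n)"] by simp
next
  case False
  note F' = powser_everywhere_has_derivative[OF F]
  let ?o = "\<lambda>n. if odd n then a n else 0"
  \<comment> \<open>The odd part has no constant term, so the shifted series has the same sum and
    can be divided by \<open>z\<close> termwise.\<close>
  have "(\<lambda>n. ?o (Suc n) * z ^ Suc n) sums odd_part F z"
    using odd_part_sums[OF F, of z] by (subst sums_Suc_iff) simp
  then have "(\<lambda>n. diffs a n * z ^ n + (2 * of_real \<mu> / z) * (?o (Suc n) * z ^ Suc n)) sums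
      (deriv F z + (2 * of_real \<mu> / z) * odd_part F z)"
    by (intro sums_add sums_mult F')
  moreover have "deriv F z + (2 * of_real \<mu> / z) * odd_part F z = D \<mu> F z"
    using D_nonzero[OF F'(2) False, of \<mu>] by (simp add: odd_part_def)
  moreover have "diffs a n * z ^ n + (2 * of_real \<mu> / z) * (?o (Suc n) * z ^ Suc n)
      = (of_real (dunkl_coeff \<mu> (Suc n)) * a (Suc n)) * z ^ n" for n
    using False by (simp add: diffs_def dunkl_coeff_def field_simps)
  ultimately show ?thesis by simp
qed

section \<open>The entropy inequality\<close>

lemma mult_ln_ge_minus_one:
  fixes t :: real
  assumes "0 \<le> t"
  shows "- 1 \<le> t * ln t"
proof (cases "t = 0")
  case False
  then have t: "0 < t" using assms by simp
  have "ln (1 / t) \<le> 1 / t - 1"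
    using t by (intro ln_le_minus_one) simp
  then have "t * (1 - 1 / t) \<le> t * ln t"
    using t by (intro mult_left_mono) (auto simp: ln_div)
  then show ?thesis
    using t by (simp add: algebra_simps)
qed simp

text \<open>Convex duality between t ln t and the exponential, from ln x \<le> x - 1 at x = r exp
  \<phi> / t. The level \<open>r\<close> stays free for optimisation.\<close>

lemma young_mult_ln:
  fixes t r \<phi> :: real
  assumes "0 \<le> t" "0 < r"
  shows "\<phi> * t \<le> t * ln t - t * ln r - t + r * exp \<phi>"
proof (cases "t = 0")
  case False
  then have t: "0 < t" using assms by simp
  have "ln (r * exp \<phi> / t) \<le> r * exp \<phi> / t - 1"
    using t assms by (intro ln_le_minus_one) simp
  then have "t * (ln r + \<phi> - ln t) \<le> t * (r * exp \<phi> / t - 1)"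
    using t assms by (intro mult_left_mono) (auto simp: ln_div ln_mult)
  then show ?thesis
    using t by (simp add: algebra_simps)
qed (use assms in simp)

text \<open>Gibbs variational principle for an unnormalised measure. Integrating
  \<open>young_mult_ln\<close> with r = N/K, where \<open>N\<close> is the squared norm, makes the
  linear terms cancel and leaves ln K times \<open>N\<close>.\<close>

lemma
  fixes \<phi> :: "'a \<Rightarrow> real"
  assumes g: "g \<in> L2 M" and \<phi> [measurable]: "\<phi> \<in> borel_measurable M" and \<phi>0: "\<And>x. 0 \<le> \<phi> x"
    and K: "(\<integral>\<^sup>+x. ennreal (exp (\<phi> x)) \<partial>M) \<le> ennreal K" "0 < K"
  shows entropy_L2_not_MInfty: "entropy_L2 M g \<noteq> - \<infinity>"
    and entropy_L2_variational:
      "enn2ereal (\<integral>\<^sup>+x. ennreal (\<phi> x * (cmod (g x))\<^sup>2) \<partial>M)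
        \<le> entropy_L2 M g + ereal (ln K * L2_normsq M g)"
proof -
  have [measurable]: "g \<in> borel_measurable M" and intg: "integrable M (\<lambda>x. (cmod (g x))\<^sup>2)"
    using g by (auto simp: L2_def)
  define t where "t = (\<lambda>x. (cmod (g x))\<^sup>2)"
  have [measurable]: "t \<in> borel_measurable M" and t0: "0 \<le> t x" for x
    by (auto simp: t_def)
  define N where "N = (LINT x|M. t x)"
  have N: "N = L2_normsq M g"
    by (simp add: N_def t_def L2_normsq_def)
  have intt: "integrable M t"
    using intg by (simp add: t_def)
  define P Q where "P = (\<integral>\<^sup>+x. ennreal (t x * ln (t x)) \<partial>M)"
    and "Q = (\<integral>\<^sup>+x. ennreal (- (t x * ln (t x))) \<partial>M)"
  have S: "entropy_L2 M g = enn2ereal P - enn2ereal Q - ereal (N * ln N)"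
    by (simp add: entropy_L2_def P_def Q_def N t_def)
  \<comment> \<open>Since \<phi> is nonnegative, its exponential is at least 1 and dominates the
    negative part of t ln t. Finiteness of the measure is thus implicit in the exponential
    bound.\<close>
  have "Q \<le> (\<integral>\<^sup>+x. ennreal (exp (\<phi> x)) \<partial>M)"
    unfolding Q_def
  proof (intro nn_integral_mono ennreal_leI)
    fix x
    have "1 \<le> exp (\<phi> x)" using \<phi>0[of x] by simp
    then show "- (t x * ln (t x)) \<le> exp (\<phi> x)"
      using mult_ln_ge_minus_one[OF t0[of x]] by linarith
  qed
  with K have Q: "Q \<noteq> \<infinity>"
    by (metis ennreal_less_top infinity_ennreal_def le_less_trans order.strict_iff_not top.extremum)
  then obtain q where q: "Q = ennreal q" "0 \<le> q"
    by (cases Q) auto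
  show "entropy_L2 M g \<noteq> - \<infinity>"
    unfolding S using q by (cases P) (auto simp: top_ereal_def)
  show "enn2ereal (\<integral>\<^sup>+x. ennreal (\<phi> x * (cmod (g x))\<^sup>2) \<partial>M)
        \<le> entropy_L2 M g + ereal (ln K * L2_normsq M g)"
  proof (cases "P = \<infinity>")
    case True
    then show ?thesis
      unfolding S using q by (simp add: top_ereal_def)
  next
    case False
    then obtain p where p: "P = ennreal p" "0 \<le> p"
      by (cases P) auto
    have int_ln: "integrable M (\<lambda>x. t x * ln (t x))"
      using False Q unfolding real_integrable_def P_def Q_def by auto
    define T where "T = (LINT x|M. t x * ln (t x))"
    have "T = p - q"
      using int_ln p q unfolding T_def P_def Q_def by (subst real_lebesgue_integral_def) auto
    then have S': "entropy_L2 M g = ereal (T - N * ln N)"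
      unfolding S using p q by simp
    \<comment> \<open>A vanishing norm is separated because the level N/K must be positive; there
      \<open>g\<close> is zero almost everywhere.\<close>
    show ?thesis
    proof (cases "N = 0")
      case True
      have "AE x in M. t x = 0"
        using True integral_nonneg_eq_0_iff_AE[OF intt] t0 by (simp add: N_def)
      then have "AE x in M. ennreal (\<phi> x * t x) = 0" "AE x in M. t x * ln (t x) = 0"
        by (auto elim: eventually_mono)
      then have "(\<integral>\<^sup>+x. ennreal (\<phi> x * t x) \<partial>M) = 0" "T = 0"
        unfolding T_def by (auto simp: nn_integral_0_iff_AE intro: integral_eq_zero_AE)
      then show ?thesis
        unfolding S' N[symmetric] using True by (simp add: t_def zero_ennreal.rep_eq)
    next
      case False
      then have N0: "0 < N"
        using t0 by (simp add: N_def order.strict_iff_order)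
      have int_exp: "integrable M (\<lambda>x. exp (\<phi> x))"
        using K by (intro integrableI_nonneg) (auto simp: top_unique intro: le_less_trans)
      have Z: "(LINT x|M. exp (\<phi> x)) \<le> K"
        using K by (subst integral_eq_nn_integral) (auto simp: enn2real_leI)
      let ?R = "\<lambda>x. t x * ln (t x) - t x * ln (N / K) - t x + N / K * exp (\<phi> x)"
      have le: "\<phi> x * t x \<le> ?R x" for x
        using young_mult_ln[OF t0, of "N / K" "\<phi> x" x] N0 K by simp
      have intR: "integrable M ?R"
        using int_ln intt int_exp by auto
      \<comment> \<open>Integrability of the energy is itself a consequence: the product is
        nonnegative and lies below the integrable right side of Young's inequality.\<close>
      have int\<phi>: "integrable M (\<lambda>x. \<phi> x * t x)"
      proof (rule Bochner_Integration.integrable_bound[OF intR])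
        show "AE x in M. norm (\<phi> x * t x) \<le> norm (?R x)"
          using le \<phi>0 t0 by (intro AE_I2) (simp add: abs_of_nonneg order_trans[OF _ abs_ge_self])
      qed measurable
      have "(LINT x|M. \<phi> x * t x) \<le> (LINT x|M. ?R x)"
        by (rule integral_mono[OF int\<phi> intR le])
      also have "\<dots> = T - N * ln (N / K) - N + N / K * (LINT x|M. exp (\<phi> x))"
        using int_ln intt int_exp by (simp add: T_def N_def)
      also have "\<dots> \<le> T - N * ln (N / K) - N + N / K * K"
        using Z N0 K by (intro add_left_mono mult_left_mono) auto
      also have "\<dots> = T - N * ln N + ln K * N"
        using N0 K by (simp add: ln_div algebra_simps)
      finally have "(LINT x|M. \<phi> x * t x) \<le> T - N * ln N + ln K * N" .
      moreover have "(\<integral>\<^sup>+x. ennreal (\<phi> x * t x) \<partial>M) = ennreal (LINT x|M. \<phi> x * t x)"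
        using \<phi>0 t0 by (intro nn_integral_eq_integral int\<phi>) auto
      moreover have "0 \<le> (LINT x|M. \<phi> x * t x)"
        using \<phi>0 t0 by simp
      ultimately show ?thesis
        unfolding S' N[symmetric] by (simp add: t_def)
    qed
  qed
qed

text \<open>The variational bound for \<phi>/c, multiplied by \<open>c\<close>.\<close>

lemma energy_le_entropy:
  fixes \<phi> :: "'a \<Rightarrow> real"
  assumes g: "g \<in> L2 M" and [measurable]: "\<phi> \<in> borel_measurable M" and \<phi>0: "\<And>x. 0 \<le> \<phi> x" and c: "0 < c"
    and K: "(\<integral>\<^sup>+x. ennreal (exp (\<phi> x / c)) \<partial>M) \<le> ennreal K" "0 < K"
  shows "enn2ereal (\<integral>\<^sup>+x. ennreal (\<phi> x * (cmod (g x))\<^sup>2) \<partial>M)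
    \<le> ereal c * entropy_L2 M g + ereal (c * ln K * L2_normsq M g)"
proof -
  have [measurable]: "g \<in> borel_measurable M"
    using g by (auto simp: L2_def)
  let ?I = "\<integral>\<^sup>+x. ennreal (\<phi> x / c * (cmod (g x))\<^sup>2) \<partial>M"
  have "(\<integral>\<^sup>+x. ennreal (\<phi> x * (cmod (g x))\<^sup>2) \<partial>M) = (\<integral>\<^sup>+x. ennreal c * ennreal (\<phi> x / c * (cmod (g x))\<^sup>2) \<partial>M)"
    using c by (simp flip: ennreal_mult')
  also have "\<dots> = ennreal c * ?I"
    by (rule nn_integral_cmult) measurable
  finally have eq: "enn2ereal (\<integral>\<^sup>+x. ennreal (\<phi> x * (cmod (g x))\<^sup>2) \<partial>M) = ereal c * enn2ereal ?I"
    using c by (simp add: times_ennreal.rep_eq)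
  have "enn2ereal ?I \<le> entropy_L2 M g + ereal (ln K * L2_normsq M g)"
    by (rule entropy_L2_variational) (use assms in auto)
  then have "ereal c * enn2ereal ?I \<le> ereal c * (entropy_L2 M g + ereal (ln K * L2_normsq M g))"
    using c by (intro ereal_mult_left_mono) auto
  also have "\<dots> = ereal c * entropy_L2 M g + ereal (c * ln K * L2_normsq M g)"
    using c entropy_L2_not_MInfty[OF g, of "\<lambda>x. \<phi> x / c" K] K \<phi>0
    by (cases "entropy_L2 M g") (auto simp: algebra_simps)
  finally show ?thesis
    unfolding eq .
qed

section \<open>Dirichlet energies\<close>

text \<open>Multiplying the weight by |z|^(2k) keeps it radial and shifts its moments by
  \<open>k\<close>; the norm is the case k = 0 and the energy the case k = 1.\<close>

lemma
  fixes a :: "nat \<Rightarrow> complex"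
  assumes \<mu>: "0 \<le> \<mu>" and \<alpha>: "\<bar>\<alpha>\<bar> < \<mu> + 3/2" and F: "\<And>z. (\<lambda>n. a n * z ^ n) sums F z"
  shows nn_integral_norm_powser:
      "(\<integral>\<^sup>+z. ennreal ((cmod (F z))\<^sup>2) \<partial>density lborel (\<lambda>z. ennreal (macdonald_weight \<mu> \<alpha> z)))
        = (\<Sum>n. ennreal ((cmod (a n))\<^sup>2 * macdonald_moment \<mu> \<alpha> n))" (is ?norm)
    and nn_integral_energy_powser:
      "(\<integral>\<^sup>+z. ennreal ((cmod z)\<^sup>2 * (cmod (F z))\<^sup>2) \<partial>density lborel (\<lambda>z. ennreal (macdonald_weight \<mu> \<alpha> z)))
        = (\<Sum>n. ennreal ((cmod (a n))\<^sup>2 * macdonald_moment \<mu> \<alpha> (Suc n)))" (is ?energy)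
proof -
  note [measurable] = powser_everywhere_borel_measurable[OF F]
  note moment = nn_integral_macdonald_weight_power[OF \<mu> \<alpha>]
  let ?w = "\<lambda>k z. ennreal (cmod z ^ (2 * k)) * ennreal (macdonald_weight \<mu> \<alpha> z)"
  have w: "(\<integral>\<^sup>+z. ennreal (cmod z ^ (2 * n)) * ?w k z \<partial>lborel) = ennreal (macdonald_moment \<mu> \<alpha> (n + k))" for n k
    unfolding moment[symmetric]
    by (simp add: ring_distribs power_add ennreal_mult' mult.assoc)
  have *: "(\<integral>\<^sup>+z. ennreal ((cmod (F z))\<^sup>2) * ?w k z \<partial>lborel)
      = (\<Sum>n. ennreal ((cmod (a n))\<^sup>2 * macdonald_moment \<mu> \<alpha> (n + k)))" for k
  proof -
    have "(\<integral>\<^sup>+z. ennreal ((cmod (F z))\<^sup>2) * ?w k z \<partial>lborel)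
        = (\<Sum>n. ennreal ((cmod (a n))\<^sup>2) * (\<integral>\<^sup>+z. ennreal (cmod z ^ (2 * n)) * ?w k z \<partial>lborel))"
    proof (rule parseval_radial[OF _ _ _ F])
      show "(\<integral>\<^sup>+z. ?w k z \<partial>lborel) < \<infinity>"
        by (simp add: moment)
    qed (simp_all add: norm_mult macdonald_weight_def)
    then show ?thesis
      unfolding w by (simp add: ennreal_mult')
  qed
  have "(\<integral>\<^sup>+z. ennreal ((cmod (F z))\<^sup>2) \<partial>density lborel (\<lambda>z. ennreal (macdonald_weight \<mu> \<alpha> z)))
    = (\<integral>\<^sup>+z. ennreal ((cmod (F z))\<^sup>2) * ?w 0 z \<partial>lborel)"
    by (subst nn_integral_density) (simp_all add: mult_ac)
  then show ?norm unfolding * by simp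
  have "(\<integral>\<^sup>+z. ennreal ((cmod z)\<^sup>2 * (cmod (F z))\<^sup>2) \<partial>density lborel (\<lambda>z. ennreal (macdonald_weight \<mu> \<alpha> z)))
    = (\<integral>\<^sup>+z. ennreal ((cmod (F z))\<^sup>2) * ?w 1 z \<partial>lborel)"
    by (subst nn_integral_density) (simp_all add: mult_ac ennreal_mult')
  then show ?energy unfolding * by simp
qed

lemma suminf_Suc_ennreal:
  fixes f :: "nat \<Rightarrow> ennreal"
  assumes "f 0 = 0"
  shows "(\<Sum>n. f (Suc n)) = (\<Sum>n. f n)"
  using suminf_offset[of f 1] assms by simp

context
  fixes \<mu> :: real and f :: "complex \<Rightarrow> complex"
  assumes \<mu>: "0 \<le> \<mu>" and f: "f holomorphic_on UNIV"
begin

lemma nu_exponent_bounds: "\<bar>\<mu> - 1/2\<bar> < \<mu> + 3/2" "\<bar>\<mu> + 1/2\<bar> < \<mu> + 3/2"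
  using \<mu> by auto

lemma D_holomorphic: "D \<mu> f holomorphic_on UNIV"
proof -
  obtain a where "\<And>z. (\<lambda>n. a n * z ^ n) sums f z"
    using entire_power_series[OF f] by blast
  from D_sums[OF this] show ?thesis
    by (rule powser_everywhere_has_derivative(2))
qed

text \<open>\<open>D \<mu>\<close> turns even powers into odd ones, and n^2 q(n-1) = n p(n) for even
  n \<ge> 1. Adding (1+2\<mu>) p(n) gives q(n+1). The additive form is valid in [0, \<infinity>] for
  every entire \<open>f\<close>.\<close>

lemma dirichlet_even_part:
  "(\<integral>\<^sup>+z. ennreal ((cmod (odd_part (D \<mu> f) z))\<^sup>2) \<partial>nu_o \<mu>)
      + ennreal (1 + 2 * \<mu>) * (\<integral>\<^sup>+z. ennreal ((cmod (even_part f z))\<^sup>2) \<partial>nu_e \<mu>)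
    = (\<integral>\<^sup>+z. ennreal ((cmod z)\<^sup>2 * (cmod (even_part f z))\<^sup>2) \<partial>nu_o \<mu>)"
proof -
  obtain a where a: "\<And>z. (\<lambda>n. a n * z ^ n) sums f z"
    using entire_power_series[OF f] by blast
  let ?p = "macdonald_moment \<mu> (\<mu> - 1/2)" and ?q = "macdonald_moment \<mu> (\<mu> + 1/2)"
  let ?e = "\<lambda>n. if even n then a n else 0"
  have p0: "0 \<le> ?p n" for n
    by (rule macdonald_moment_nonneg[OF \<mu>])
  have "(\<integral>\<^sup>+z. ennreal ((cmod (odd_part (D \<mu> f) z))\<^sup>2) \<partial>nu_o \<mu>)
    = (\<Sum>n. ennreal ((cmod (if odd n then of_real (dunkl_coeff \<mu> (Suc n)) * a (Suc n) else 0))\<^sup>2 * ?q n))"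
    unfolding nu_o_eq_macdonald_weight
    by (rule nn_integral_norm_powser[OF \<mu> nu_exponent_bounds(2) odd_part_sums[OF D_sums[OF a]]])
  also have "\<dots> = (\<Sum>n. ennreal (real (Suc n) * (cmod (?e (Suc n)))\<^sup>2 * ?p (Suc n)))"
    by (intro suminf_cong arg_cong[where f = ennreal])
       (auto simp: dunkl_coeff_def macdonald_moment_Suc_minus[OF \<mu>] norm_mult power2_eq_square mult_ac
          simp del: of_real_add of_nat_Suc)
  \<comment> \<open>The added term n = 0 carries the factor n and vanishes.\<close>
  also have "\<dots> = (\<Sum>n. ennreal (real n * (cmod (?e n))\<^sup>2 * ?p n))"
    by (rule suminf_Suc_ennreal) simp
  finally have X: "(\<integral>\<^sup>+z. ennreal ((cmod (odd_part (D \<mu> f) z))\<^sup>2) \<partial>nu_o \<mu>)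
    = (\<Sum>n. ennreal (real n * (cmod (?e n))\<^sup>2 * ?p n))" .
  have N: "(\<integral>\<^sup>+z. ennreal ((cmod (even_part f z))\<^sup>2) \<partial>nu_e \<mu>) = (\<Sum>n. ennreal ((cmod (?e n))\<^sup>2 * ?p n))"
    unfolding nu_e_eq_macdonald_weight
    by (rule nn_integral_norm_powser[OF \<mu> nu_exponent_bounds(1) even_part_sums[OF a]])
  have Y: "(\<integral>\<^sup>+z. ennreal ((cmod z)\<^sup>2 * (cmod (even_part f z))\<^sup>2) \<partial>nu_o \<mu>) = (\<Sum>n. ennreal ((cmod (?e n))\<^sup>2 * ?q (Suc n)))"
    unfolding nu_o_eq_macdonald_weight
    by (rule nn_integral_energy_powser[OF \<mu> nu_exponent_bounds(2) even_part_sums[OF a]])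
  show ?thesis
    unfolding X N Y ennreal_suminf_cmult[symmetric] suminf_add[OF summableI summableI]
    using \<mu> p0
    by (intro suminf_cong)
       (simp add: macdonald_moment_Suc_plus[OF \<mu>] algebra_simps flip: ennreal_mult' ennreal_plus)
qed

text \<open>For odd n, (n+2\<mu>)^2 p(n-1) = (n+2\<mu>) q(n), and p(n+1) = (n+1) q(n). The 2\<mu>
  term stands on the right because 1 - 2\<mu> may be negative, which \<open>ennreal\<close> cannot
  represent.\<close>

lemma dirichlet_odd_part:
  "(\<integral>\<^sup>+z. ennreal ((cmod (even_part (D \<mu> f) z))\<^sup>2) \<partial>nu_e \<mu>)
      + (\<integral>\<^sup>+z. ennreal ((cmod (odd_part f z))\<^sup>2) \<partial>nu_o \<mu>)
    = (\<integral>\<^sup>+z. ennreal ((cmod z)\<^sup>2 * (cmod (odd_part f z))\<^sup>2) \<partial>nu_e \<mu>)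
      + ennreal (2 * \<mu>) * (\<integral>\<^sup>+z. ennreal ((cmod (odd_part f z))\<^sup>2) \<partial>nu_o \<mu>)"
proof -
  obtain a where a: "\<And>z. (\<lambda>n. a n * z ^ n) sums f z"
    using entire_power_series[OF f] by blast
  let ?p = "macdonald_moment \<mu> (\<mu> - 1/2)" and ?q = "macdonald_moment \<mu> (\<mu> + 1/2)"
  let ?o = "\<lambda>n. if odd n then a n else 0"
  have q0: "0 \<le> ?q n" for n
    by (rule macdonald_moment_nonneg[OF \<mu>])
  have "(\<integral>\<^sup>+z. ennreal ((cmod (even_part (D \<mu> f) z))\<^sup>2) \<partial>nu_e \<mu>)
    = (\<Sum>n. ennreal ((cmod (if even n then of_real (dunkl_coeff \<mu> (Suc n)) * a (Suc n) else 0))\<^sup>2 * ?p n))"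
    unfolding nu_e_eq_macdonald_weight
    by (rule nn_integral_norm_powser[OF \<mu> nu_exponent_bounds(1) even_part_sums[OF D_sums[OF a]]])
  also have "\<dots> = (\<Sum>n. ennreal ((real (Suc n) + 2 * \<mu>) * (cmod (?o (Suc n)))\<^sup>2 * ?q (Suc n)))"
    using \<mu> by (intro suminf_cong arg_cong[where f = ennreal])
       (auto simp: dunkl_coeff_def macdonald_moment_Suc_plus[OF \<mu>] norm_mult power2_eq_square mult_ac add_ac
          simp del: of_real_add)
  also have "\<dots> = (\<Sum>n. ennreal ((real n + 2 * \<mu>) * (cmod (?o n))\<^sup>2 * ?q n))"
    by (rule suminf_Suc_ennreal) simp
  finally have X: "(\<integral>\<^sup>+z. ennreal ((cmod (even_part (D \<mu> f) z))\<^sup>2) \<partial>nu_e \<mu>)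
    = (\<Sum>n. ennreal ((real n + 2 * \<mu>) * (cmod (?o n))\<^sup>2 * ?q n))" .
  have N: "(\<integral>\<^sup>+z. ennreal ((cmod (odd_part f z))\<^sup>2) \<partial>nu_o \<mu>) = (\<Sum>n. ennreal ((cmod (?o n))\<^sup>2 * ?q n))"
    unfolding nu_o_eq_macdonald_weight
    by (rule nn_integral_norm_powser[OF \<mu> nu_exponent_bounds(2) odd_part_sums[OF a]])
  have Y: "(\<integral>\<^sup>+z. ennreal ((cmod z)\<^sup>2 * (cmod (odd_part f z))\<^sup>2) \<partial>nu_e \<mu>) = (\<Sum>n. ennreal ((cmod (?o n))\<^sup>2 * ?p (Suc n)))"
    unfolding nu_e_eq_macdonald_weight
    by (rule nn_integral_energy_powser[OF \<mu> nu_exponent_bounds(1) odd_part_sums[OF a]])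
  show ?thesis
    unfolding X N Y ennreal_suminf_cmult[symmetric] suminf_add[OF summableI summableI]
    using \<mu> q0
    by (intro suminf_cong)
       (simp add: macdonald_moment_Suc_minus[OF \<mu>] algebra_simps flip: ennreal_mult' ennreal_plus)
qed

lemma energy_even_part_nu_o_le:
  "(\<integral>\<^sup>+z. ennreal ((cmod z)\<^sup>2 * (cmod (even_part f z))\<^sup>2) \<partial>nu_o \<mu>)
    \<le> ennreal (1 + 2 * \<mu>) * E_e \<mu> (even_part f)"
proof -
  obtain a where a: "\<And>z. (\<lambda>n. a n * z ^ n) sums f z"
    using entire_power_series[OF f] by blast
  show ?thesis
    unfolding E_e_def nu_o_eq_macdonald_weight nu_e_eq_macdonald_weight
      nn_integral_energy_powser[OF \<mu> nu_exponent_bounds(1) even_part_sums[OF a]]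
      nn_integral_energy_powser[OF \<mu> nu_exponent_bounds(2) even_part_sums[OF a]]
      ennreal_suminf_cmult[symmetric]
  proof (intro suminf_le summableI)
    fix n
    let ?x = "(cmod (if even n then a n else 0))\<^sup>2"
    have "?x * macdonald_moment \<mu> (\<mu> + 1/2) (Suc n) \<le> ?x * ((1 + 2 * \<mu>) * macdonald_moment \<mu> (\<mu> - 1/2) (Suc n))"
      by (intro mult_left_mono macdonald_moment_plus_le_minus \<mu>) simp
    then show "ennreal (?x * macdonald_moment \<mu> (\<mu> + 1/2) (Suc n))
        \<le> ennreal (1 + 2 * \<mu>) * ennreal (?x * macdonald_moment \<mu> (\<mu> - 1/2) (Suc n))"
      using \<mu> by (subst ennreal_mult'[symmetric]) (auto simp: mult.left_commute intro!: ennreal_leI)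
  qed
qed

text \<open>Here p(n+1) \<le> q(n+1) already suffices, so the odd case needs no constant beyond
  1.\<close>

lemma energy_odd_part_nu_e_le:
  "(\<integral>\<^sup>+z. ennreal ((cmod z)\<^sup>2 * (cmod (odd_part f z))\<^sup>2) \<partial>nu_e \<mu>) \<le> E_o \<mu> (odd_part f)"
proof -
  obtain a where a: "\<And>z. (\<lambda>n. a n * z ^ n) sums f z"
    using entire_power_series[OF f] by blast
  show ?thesis
    unfolding E_o_def nu_o_eq_macdonald_weight nu_e_eq_macdonald_weight
      nn_integral_energy_powser[OF \<mu> nu_exponent_bounds(1) odd_part_sums[OF a]]
      nn_integral_energy_powser[OF \<mu> nu_exponent_bounds(2) odd_part_sums[OF a]]
    using \<mu> macdonald_moment_mono[OF \<mu>]
    by (intro suminf_le summableI ennreal_leI mult_left_mono) auto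
qed

end

section \<open>Exponential integrability and the bound by energies\<close>

lemma
  assumes \<mu>: "0 \<le> \<mu>"
  shows nu_e_exp_bound: "1 < c \<Longrightarrow> \<exists>K>0. (\<integral>\<^sup>+z. ennreal (exp ((cmod z)\<^sup>2 / c)) \<partial>nu_e \<mu>) \<le> ennreal K"
    and nu_o_exp_bound: "1 < c \<Longrightarrow> \<exists>K>0. (\<integral>\<^sup>+z. ennreal (exp ((cmod z)\<^sup>2 / c)) \<partial>nu_o \<mu>) \<le> ennreal K"
proof -
  have *: "\<exists>K>0. (\<integral>\<^sup>+z. ennreal (exp ((cmod z)\<^sup>2 / c)) \<partial>density lborel (\<lambda>z. ennreal (macdonald_weight \<mu> \<alpha> z))) \<le> ennreal K"
    if \<alpha>: "\<bar>\<alpha>\<bar> < \<mu> + 3/2" and c: "1 < c" for \<alpha> c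
  proof -
    define I where "I = (\<integral>\<^sup>+z. ennreal (exp ((cmod z)\<^sup>2 / c)) \<partial>density lborel (\<lambda>z. ennreal (macdonald_weight \<mu> \<alpha> z)))"
    have "I = (\<integral>\<^sup>+z. ennreal (exp (1 / c * (cmod z)\<^sup>2)) * ennreal (macdonald_weight \<mu> \<alpha> z) \<partial>lborel)"
      unfolding I_def by (subst nn_integral_density) (simp_all add: mult.commute)
    also have "\<dots> < \<infinity>"
      using c by (intro nn_integral_macdonald_weight_exp_finite \<mu> \<alpha>) auto
    finally obtain k where k: "I = ennreal k" "0 \<le> k"
      by (cases I) auto
    \<comment> \<open>Adding 1 guarantees a positive bound, as its logarithm is taken later.\<close>
    then have "I \<le> ennreal (1 + k)"
      by (auto intro: ennreal_leI)
    then show ?thesis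
      using k unfolding I_def by (intro exI[of _ "1 + k"]) auto
  qed
  show "1 < c \<Longrightarrow> \<exists>K>0. (\<integral>\<^sup>+z. ennreal (exp ((cmod z)\<^sup>2 / c)) \<partial>nu_e \<mu>) \<le> ennreal K"
    unfolding nu_e_eq_macdonald_weight using \<mu> by (intro *) auto
  show "1 < c \<Longrightarrow> \<exists>K>0. (\<integral>\<^sup>+z. ennreal (exp ((cmod z)\<^sup>2 / c)) \<partial>nu_o \<mu>) \<le> ennreal K"
    unfolding nu_o_eq_macdonald_weight using \<mu> by (intro *) auto
qed

lemma nn_integral_eq_L2_normsq:
  "g \<in> L2 M \<Longrightarrow> (\<integral>\<^sup>+x. ennreal ((cmod (g x))\<^sup>2) \<partial>M) = ennreal (L2_normsq M g)"
  unfolding L2_def L2_normsq_def by (intro nn_integral_eq_integral) auto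

lemma L2_normsq_nonneg: "0 \<le> L2_normsq M g"
  unfolding L2_normsq_def by simp

lemma L2I:
  assumes "g \<in> borel_measurable M" "(\<integral>\<^sup>+x. ennreal ((cmod (g x))\<^sup>2) \<partial>M) < \<infinity>"
  shows "g \<in> L2 M"
  using assms unfolding L2_def by (auto intro!: integrableI_nonneg)

lemma entropy_L2_zero: "entropy_L2 M (\<lambda>x. 0) = 0"
  by (simp add: entropy_L2_def L2_normsq_def zero_ennreal.rep_eq)

lemma L2_normsq_zero: "L2_normsq M (\<lambda>x. 0) = 0"
  by (simp add: L2_normsq_def)

lemma entire_measurable_nu:
  assumes "g holomorphic_on UNIV"
  shows "even_part g \<in> borel_measurable (nu_e \<mu>)" "odd_part g \<in> borel_measurable (nu_o \<mu>)"
proof -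
  have [measurable]: "g \<in> borel_measurable borel"
    using assms by (intro borel_measurable_continuous_onI holomorphic_on_imp_continuous_on)
  show "even_part g \<in> borel_measurable (nu_e \<mu>)" "odd_part g \<in> borel_measurable (nu_o \<mu>)"
    unfolding nu_e_def nu_o_def even_part_def[abs_def] odd_part_def[abs_def] by measurable
qed

text \<open>With finite energies the additive identities become real ones and can be solved for the
  norm of \<open>D \<mu> f\<close>.\<close>

lemma dirichlet_energy_le_energies:
  assumes \<mu>: "0 \<le> \<mu>" and f: "f \<in> B \<mu>"
    and fin: "E_e \<mu> (even_part f) < \<infinity>" "E_o \<mu> (odd_part f) < \<infinity>"
  shows "dirichlet_energy \<mu> f \<le> ereal
      ((1 + 2 * \<mu>) * enn2real (E_e \<mu> (even_part f)) - (1 + 2 * \<mu>) * L2_normsq (nu_e \<mu>) (even_part f)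
        + enn2real (E_o \<mu> (odd_part f)) - (1 - 2 * \<mu>) * L2_normsq (nu_o \<mu>) (odd_part f))"
proof -
  have hol: "f holomorphic_on UNIV" and L2: "even_part f \<in> L2 (nu_e \<mu>)" "odd_part f \<in> L2 (nu_o \<mu>)"
    using f by (auto simp: B_def)
  let ?Ne = "L2_normsq (nu_e \<mu>) (even_part f)" and ?No = "L2_normsq (nu_o \<mu>) (odd_part f)"
  obtain e o' where e: "E_e \<mu> (even_part f) = ennreal e" "0 \<le> e" and o': "E_o \<mu> (odd_part f) = ennreal o'" "0 \<le> o'"
    using fin by (cases "E_e \<mu> (even_part f)"; cases "E_o \<mu> (odd_part f)") auto
  \<comment> \<open>The indices refer to the parity of the part of \<open>f\<close>; its derivative
    has the opposite parity and is measured in the other space.\<close>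
  define X\<^sub>e where "X\<^sub>e = (\<integral>\<^sup>+z. ennreal ((cmod (odd_part (D \<mu> f) z))\<^sup>2) \<partial>nu_o \<mu>)"
  define X\<^sub>o where "X\<^sub>o = (\<integral>\<^sup>+z. ennreal ((cmod (even_part (D \<mu> f) z))\<^sup>2) \<partial>nu_e \<mu>)"
  have Xe: "X\<^sub>e + ennreal ((1 + 2 * \<mu>) * ?Ne) \<le> ennreal ((1 + 2 * \<mu>) * e)"
    using dirichlet_even_part[OF \<mu> hol] energy_even_part_nu_o_le[OF \<mu> hol] \<mu>
    by (simp add: X\<^sub>e_def nn_integral_eq_L2_normsq[OF L2(1)] e ennreal_mult')
  have Xo: "X\<^sub>o + ennreal ?No \<le> ennreal (o' + 2 * \<mu> * ?No)"
    using dirichlet_odd_part[OF \<mu> hol] energy_odd_part_nu_e_le[OF \<mu> hol] \<mu> o'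
    by (simp add: X\<^sub>o_def nn_integral_eq_L2_normsq[OF L2(2)] ennreal_mult' add_right_mono L2_normsq_nonneg)
  have "X\<^sub>e < \<infinity>" "X\<^sub>o < \<infinity>"
    using Xe Xo by (auto simp: less_top[symmetric] top_unique)
  then have DL2: "odd_part (D \<mu> f) \<in> L2 (nu_o \<mu>)" "even_part (D \<mu> f) \<in> L2 (nu_e \<mu>)"
    using entire_measurable_nu[OF D_holomorphic[OF \<mu> hol]]
    by (auto intro!: L2I simp: X\<^sub>e_def X\<^sub>o_def)
  \<comment> \<open>This selects the finite branch of \<open>dirichlet_energy\<close>.\<close>
  then have DB: "D \<mu> f \<in> B \<mu>"
    using D_holomorphic[OF \<mu> hol] by (simp add: B_def)
  have "L2_normsq (nu_o \<mu>) (odd_part (D \<mu> f)) + (1 + 2 * \<mu>) * ?Ne \<le> (1 + 2 * \<mu>) * e"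
    using Xe \<mu> e unfolding X\<^sub>e_def nn_integral_eq_L2_normsq[OF DL2(1)]
    by (simp add: L2_normsq_nonneg flip: ennreal_plus)
  moreover have "L2_normsq (nu_e \<mu>) (even_part (D \<mu> f)) + ?No \<le> o' + 2 * \<mu> * ?No"
    using Xo \<mu> o' unfolding X\<^sub>o_def nn_integral_eq_L2_normsq[OF DL2(2)]
    by (simp add: L2_normsq_nonneg flip: ennreal_plus)
  ultimately show ?thesis
    using DB e o' by (simp add: dirichlet_energy_def B_normsq_def algebra_simps)
qed

section \<open>Assembly of the inequalities\<close>

lemma part_even:
  assumes "\<And>z. g (- z) = g z"
  shows "even_part g = g" "odd_part g = (\<lambda>z. 0)"
  using assms by (auto simp: even_part_def odd_part_def fun_eq_iff)

lemma part_odd: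
  assumes "\<And>z. g (- z) = - g z"
  shows "even_part g = (\<lambda>z. 0)" "odd_part g = g"
  using assms by (auto simp: even_part_def odd_part_def fun_eq_iff)

theorem theorem5p2:
  fixes \<mu> :: real
  assumes "0 \<le> \<mu>"
  shows "\<exists>(C :: real) (\<tau>\<^sub>e :: real \<Rightarrow> real) (\<tau>\<^sub>o :: real \<Rightarrow> real).
    (0 < \<mu> \<longrightarrow> 1 < C) \<and> (\<mu> = 0 \<longrightarrow> C = 1) \<and>
    (\<forall>g \<in> B_e \<mu>. (\<integral>\<^sup>+z. ennreal ((cmod z)\<^sup>2 * (cmod (g z))\<^sup>2) \<partial>nu_o \<mu>) \<le> ennreal C * E_e \<mu> g) \<and>
    (\<forall>c > 1.
      (\<forall>g \<in> B_e \<mu>. enn2ereal (E_e \<mu> g)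
          \<le> ereal c * entropy_L2 (nu_e \<mu>) g + ereal (\<tau>\<^sub>e c * L2_normsq (nu_e \<mu>) g)) \<and>
      (\<forall>h \<in> B_o \<mu>. enn2ereal (E_o \<mu> h)
          \<le> ereal c * entropy_L2 (nu_o \<mu>) h + ereal (\<tau>\<^sub>o c * L2_normsq (nu_o \<mu>) h)) \<and>
      (\<forall>g \<in> B_e \<mu>. dirichlet_energy \<mu> g
          \<le> ereal (c * C) * entropy_L2 (nu_e \<mu>) g
            + ereal ((C * \<tau>\<^sub>e c - (1 + 2 * \<mu>)) * L2_normsq (nu_e \<mu>) g)) \<and>
      (\<forall>h \<in> B_o \<mu>. dirichlet_energy \<mu> h
          \<le> ereal c * entropy_L2 (nu_o \<mu>) h
            + ereal ((\<tau>\<^sub>o c - (1 - 2 * \<mu>)) * L2_normsq (nu_o \<mu>) h)) \<and>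
      (\<forall>f \<in> B \<mu>. dirichlet_energy \<mu> f
          \<le> ereal (c * C) * entropy_L2 (nu_e \<mu>) (even_part f)
            + ereal c * entropy_L2 (nu_o \<mu>) (odd_part f)
            + ereal ((C * \<tau>\<^sub>e c - (1 + 2 * \<mu>)) * L2_normsq (nu_e \<mu>) (even_part f))
            + ereal ((\<tau>\<^sub>o c - (1 - 2 * \<mu>)) * L2_normsq (nu_o \<mu>) (odd_part f))))"
proof -
  note \<mu> = assms
  obtain K\<^sub>e where Ke: "0 < K\<^sub>e c" "(\<integral>\<^sup>+z. ennreal (exp ((cmod z)\<^sup>2 / c)) \<partial>nu_e \<mu>) \<le> ennreal (K\<^sub>e c)" if "1 < c" for c
    using nu_e_exp_bound[OF \<mu>] by metis
  obtain K\<^sub>o where Ko: "0 < K\<^sub>o c" "(\<integral>\<^sup>+z. ennreal (exp ((cmod z)\<^sup>2 / c)) \<partial>nu_o \<mu>) \<le> ennreal (K\<^sub>o c)" if "1 < c" for c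
    using nu_o_exp_bound[OF \<mu>] by metis
  \<comment> \<open>The constant delivered by \<open>energy_le_entropy\<close>; the choice function
    is constrained only for c > 1.\<close>
  define \<tau>\<^sub>e where "\<tau>\<^sub>e = (\<lambda>c. c * ln (K\<^sub>e c))"
  define \<tau>\<^sub>o where "\<tau>\<^sub>o = (\<lambda>c. c * ln (K\<^sub>o c))"
  define C where "C = 1 + 2 * \<mu>"
  have C: "0 < C" using \<mu> by (simp add: C_def)
  have meas: "(\<lambda>z. (cmod z)\<^sup>2) \<in> borel_measurable (nu_e \<mu>)" "(\<lambda>z. (cmod z)\<^sup>2) \<in> borel_measurable (nu_o \<mu>)"
    by (auto simp: nu_e_def nu_o_def)
  have e_le: "enn2ereal (E_e \<mu> g) \<le> ereal c * entropy_L2 (nu_e \<mu>) g + ereal (\<tau>\<^sub>e c * L2_normsq (nu_e \<mu>) g)"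
    if "1 < c" "g \<in> L2 (nu_e \<mu>)" for c g
    unfolding E_e_def \<tau>\<^sub>e_def
    using energy_le_entropy[OF that(2) meas(1) _ _ Ke(2)[OF that(1)] Ke(1)[OF that(1)]] that by simp
  have o_le: "enn2ereal (E_o \<mu> h) \<le> ereal c * entropy_L2 (nu_o \<mu>) h + ereal (\<tau>\<^sub>o c * L2_normsq (nu_o \<mu>) h)"
    if "1 < c" "h \<in> L2 (nu_o \<mu>)" for c h
    unfolding E_o_def \<tau>\<^sub>o_def
    using energy_le_entropy[OF that(2) meas(2) _ _ Ko(2)[OF that(1)] Ko(1)[OF that(1)]] that by simp
  \<comment> \<open>The general case comes first; the even and odd ones are specialisations in which
    the other part is zero and contributes neither entropy nor norm.\<close>
  have main: "dirichlet_energy \<mu> f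
          \<le> ereal (c * C) * entropy_L2 (nu_e \<mu>) (even_part f)
            + ereal c * entropy_L2 (nu_o \<mu>) (odd_part f)
            + ereal ((C * \<tau>\<^sub>e c - (1 + 2 * \<mu>)) * L2_normsq (nu_e \<mu>) (even_part f))
            + ereal ((\<tau>\<^sub>o c - (1 - 2 * \<mu>)) * L2_normsq (nu_o \<mu>) (odd_part f))" (is "_ \<le> ?rhs")
    if c: "1 < c" and f: "f \<in> B \<mu>" for c f
  proof -
    have L2: "even_part f \<in> L2 (nu_e \<mu>)" "odd_part f \<in> L2 (nu_o \<mu>)"
      using f by (auto simp: B_def)
    let ?Se = "entropy_L2 (nu_e \<mu>) (even_part f)" and ?So = "entropy_L2 (nu_o \<mu>) (odd_part f)"
    have nm: "?Se \<noteq> -\<infinity>" "?So \<noteq> -\<infinity>"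
      using entropy_L2_not_MInfty[OF L2(1), of "\<lambda>z. (cmod z)\<^sup>2 / c" "K\<^sub>e c"] Ke[OF c]
        entropy_L2_not_MInfty[OF L2(2), of "\<lambda>z. (cmod z)\<^sup>2 / c" "K\<^sub>o c"] Ko[OF c] meas c by auto
    show ?thesis
    \<comment> \<open>Neither entropy is -\<infinity>, so one infinite entropy makes the right side
      infinite. Otherwise the entropy bounds force finite energies.\<close>
    proof (cases "?Se = \<infinity> \<or> ?So = \<infinity>")
      case True
      then have "?rhs = \<infinity>"
        using nm c C by (cases ?Se; cases ?So) auto
      then show ?thesis by (simp only: ereal_less_eq)
    next
      case False
      with nm obtain s\<^sub>e s\<^sub>o where s: "?Se = ereal s\<^sub>e" "?So = ereal s\<^sub>o"
        by (cases ?Se; cases ?So) auto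
      have E: "E_e \<mu> (even_part f) < \<infinity>" "E_o \<mu> (odd_part f) < \<infinity>"
        using e_le[OF c L2(1)] o_le[OF c L2(2)] unfolding s
        by (auto simp: less_top[symmetric] top_ereal_def)
      then obtain e o' where eo: "E_e \<mu> (even_part f) = ennreal e" "0 \<le> e" "E_o \<mu> (odd_part f) = ennreal o'" "0 \<le> o'"
        by (cases "E_e \<mu> (even_part f)"; cases "E_o \<mu> (odd_part f)") auto
      have "e \<le> c * s\<^sub>e + \<tau>\<^sub>e c * L2_normsq (nu_e \<mu>) (even_part f)"
        using e_le[OF c L2(1)] by (simp add: s eo)
      then have "C * e \<le> C * (c * s\<^sub>e + \<tau>\<^sub>e c * L2_normsq (nu_e \<mu>) (even_part f))"
        using C by (intro mult_left_mono) auto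
      moreover have "o' \<le> c * s\<^sub>o + \<tau>\<^sub>o c * L2_normsq (nu_o \<mu>) (odd_part f)"
        using o_le[OF c L2(2)] by (simp add: s eo)
      ultimately show ?thesis
        using dirichlet_energy_le_energies[OF \<mu> f E]
        unfolding s C_def[symmetric] by (elim order_trans) (simp add: eo algebra_simps)
    qed
  qed
  show ?thesis
  proof (rule exI[of _ C], rule exI[of _ \<tau>\<^sub>e], rule exI[of _ \<tau>\<^sub>o], intro conjI allI impI ballI)
    fix g assume "g \<in> B_e \<mu>"
    then have g: "g \<in> B \<mu>" "g holomorphic_on UNIV" "even_part g = g" "odd_part g = (\<lambda>z. 0)"
      using part_even[of g] by (auto simp: B_e_def B_def)
    show "(\<integral>\<^sup>+z. ennreal ((cmod z)\<^sup>2 * (cmod (g z))\<^sup>2) \<partial>nu_o \<mu>) \<le> ennreal C * E_e \<mu> g"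
      using energy_even_part_nu_o_le[OF \<mu> g(2)] by (simp add: g C_def)
    fix c :: real assume c: "1 < c"
    show "enn2ereal (E_e \<mu> g) \<le> ereal c * entropy_L2 (nu_e \<mu>) g + ereal (\<tau>\<^sub>e c * L2_normsq (nu_e \<mu>) g)"
      using e_le[OF c, of g] g by (simp add: B_def)
    show "dirichlet_energy \<mu> g \<le> ereal (c * C) * entropy_L2 (nu_e \<mu>) g
            + ereal ((C * \<tau>\<^sub>e c - (1 + 2 * \<mu>)) * L2_normsq (nu_e \<mu>) g)"
      using main[OF c g(1)] by (simp add: g entropy_L2_zero L2_normsq_zero)
  next
    fix c h assume c: "(1 :: real) < c" and "h \<in> B_o \<mu>"
    then have h: "h \<in> B \<mu>" "even_part h = (\<lambda>z. 0)" "odd_part h = h"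
      using part_odd[of h] by (auto simp: B_o_def)
    show "enn2ereal (E_o \<mu> h) \<le> ereal c * entropy_L2 (nu_o \<mu>) h + ereal (\<tau>\<^sub>o c * L2_normsq (nu_o \<mu>) h)"
      using o_le[OF c, of h] h by (simp add: B_def)
    show "dirichlet_energy \<mu> h \<le> ereal c * entropy_L2 (nu_o \<mu>) h
            + ereal ((\<tau>\<^sub>o c - (1 - 2 * \<mu>)) * L2_normsq (nu_o \<mu>) h)"
      using main[OF c h(1)] by (simp add: h entropy_L2_zero L2_normsq_zero)
  qed (use main in \<open>auto simp: C_def\<close>)
qed

end
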